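(* Let $t\ge 1$ be a constant integer independent of $d$. There exist a constant $c>0$ (possibly depending on $t$) and an integer $d_0$ such that for every integer $d\ge d_0$, every $d$-dimensional rectilinear drawing of $K_{2d}^d$ whose $2d$ vertices are the vertices of a $d$-dimensional convex polytope that is $t$-neighborly but not $(t+1)$-neighborly has at least $c\,2^d d^{3/2}$ crossing pairs of hyperedges; i.e., the number of crossing pairs is $\Omega(2^d d^{3/2})$.
   Context: $K_{2d}^d$ denotes the complete $d$-uniform hypergraph on $2d$ vertices. A $d$-dimensional rectilinear drawing of it places the vertices at points in general position in $\mathbb{R}^d$ (no $d+1$ on a common affine hyperplane) and draws each hyperedge as the $(d-1)$-simplex spanned by its $d$ vertices. Two hyperedges form a crossing pair if they have no common vertex and their simplices share a point of their relative interiors. For $t\ge1$, a $d$-dimensional convex polytope is $t$-neighborly if every subset of its vertex set with at most $t$ vertices is the vertex set of a face of the polytope. Asymptotic notation is as $d\to\infty$. *)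

theory Defs
  imports "HOL-Analysis.Analysis" "HOL-Analysis.Finite_Function_Topology"
begin

text \<open>
  The dimension \<open>d\<close> is quantified inside the statement, so \<open>\<real>\<^sup>d\<close> cannot be a
  type. It is represented as the \<open>d\<close>-dimensional coordinate subspace of the normed space
  \<open>nat \<Rightarrow>\<^sub>0 real\<close> of finitely supported sequences. The norm there is the sum norm,
  which on each coordinate subspace induces the usual Euclidean topology.
\<close>

type_synonym point = "nat \<Rightarrow>\<^sub>0 real"

definition Rspace :: "nat \<Rightarrow> point set" where
  "Rspace d = {x. Poly_Mapping.keys x \<subseteq> {..<d}}"

definition affine_hyperplane :: "nat \<Rightarrow> point set \<Rightarrow> bool" where
  "affine_hyperplane d H \<longleftrightarrow>
     (\<exists>(a :: nat \<Rightarrow> real) (b :: real). (\<exists>i<d. a i \<noteq> 0) \<and>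
        H = {x \<in> Rspace d. (\<Sum>i<d. a i * Poly_Mapping.lookup x i) = b})"

text \<open>The complete \<open>d\<close>-uniform hypergraph on \<open>n\<close> vertices has vertex set \<open>{..<n}\<close>.\<close>

definition complete_hyperedges :: "nat \<Rightarrow> nat \<Rightarrow> nat set set" where
  "complete_hyperedges n d = {e. e \<subseteq> {..<n} \<and> card e = d}"

definition rectilinear_drawing :: "nat \<Rightarrow> nat \<Rightarrow> (nat \<Rightarrow> point) \<Rightarrow> bool" where
  "rectilinear_drawing n d p \<longleftrightarrow>
     inj_on p {..<n} \<and> p ` {..<n} \<subseteq> Rspace d \<and>
     (\<forall>I \<subseteq> {..<n}. card I = d + 1 \<longrightarrow> \<not> (\<exists>H. affine_hyperplane d H \<and> p ` I \<subseteq> H))"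

definition drawn_hyperedge :: "(nat \<Rightarrow> point) \<Rightarrow> nat set \<Rightarrow> point set" where
  "drawn_hyperedge p e = convex hull (p ` e)"

definition crossing :: "(nat \<Rightarrow> point) \<Rightarrow> nat set \<Rightarrow> nat set \<Rightarrow> bool" where
  "crossing p A B \<longleftrightarrow> A \<inter> B = {} \<and>
     rel_interior (drawn_hyperedge p A) \<inter> rel_interior (drawn_hyperedge p B) \<noteq> {}"

definition crossing_pairs :: "nat \<Rightarrow> nat \<Rightarrow> (nat \<Rightarrow> point) \<Rightarrow> nat set set set" where
  "crossing_pairs n d p =
     {{A, B} | A B. A \<in> complete_hyperedges n d \<and> B \<in> complete_hyperedges n d \<and> crossing p A B}"

definition polytope_vertices :: "point set \<Rightarrow> point set" where
  "polytope_vertices P = {v. v extreme_point_of P}"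

text \<open>The library's \<open>aff_dim\<close> is restricted to Euclidean space types; for a subset of
  \<open>\<real>\<^sup>d\<close>, being \<open>d\<close>-dimensional means having affine hull \<open>\<real>\<^sup>d\<close>.\<close>

definition full_dim_polytope :: "nat \<Rightarrow> point set \<Rightarrow> bool" where
  "full_dim_polytope d P \<longleftrightarrow> polytope P \<and> affine hull P = Rspace d"

definition neighborly :: "nat \<Rightarrow> point set \<Rightarrow> bool" where
  "neighborly t P \<longleftrightarrow>
     (\<forall>S \<subseteq> polytope_vertices P. finite S \<and> card S \<le> t \<longrightarrow>
        (\<exists>F. F face_of P \<and> polytope_vertices F = S))"

end

theory Submission
  imports Defs
begin

text \<open>
  Complementary hyperedges cross iff some affine dependency of the \<open>2d\<close> points is positive on one
  and negative on the other. Failure of \<open>(t+1)\<close>-neighborliness gives a dependency \<open>u\<close> with at most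
  \<open>t + 1\<close> negative coefficients. By the Caratheodory argument and a perturbation, its support may be
  taken to be a set \<open>T\<close> of exactly \<open>d + 5\<close> points. The dependencies supported on \<open>T\<close> form a space of
  dimension 4; dividing them by \<open>u\<close> gives a space \<open>M\<close> of functions on \<open>T\<close> that contains the constants,
  so sign patterns of \<open>M\<close> are splittings by planes of \<open>d + 5\<close> points of \<open>\<real>\<^sup>3\<close> in general position.

  Rotating a plane about the line through two of these points shows that each pair lies on a plane
  through three points that halves the others, so there are at least quadratically many halving
  planes. The halving partitions are the cells of a subdivision of the sphere of directions with the
  halving planes as vertices. For generic linear functionals \<open>g\<close> and \<open>h\<close>, each vertex is the minimum
  or the maximum of \<open>h / g\<close> on one of its three cells, hence the number of halving partitions is
  quadratic as well.

  By general position, each of the resulting sign patterns on \<open>T\<close> extends to a dependency with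
  arbitrary signs on the remaining \<open>d - 5\<close> points. Undoing the division by \<open>u\<close> changes the number of
  positive signs by at most \<open>t + 1\<close>, so \<open>\<Omega>(2\<^sup>d / \<surd>d)\<close> of these extensions are balanced.
\<close>

definition isgn :: "real \<Rightarrow> int" where
  "isgn x = (if x > 0 then 1 else if x < 0 then - 1 else 0)"

lemma isgn_minus: "isgn (- x) = - isgn x"
  by (simp add: isgn_def)

lemma isgn_mult: "isgn (x * y) = isgn x * isgn y"
  by (auto simp: isgn_def zero_less_mult_iff mult_less_0_iff)

lemma sum_isgn:
  assumes "finite T"
  shows "(\<Sum>i\<in>T. isgn (u i)) = int (card {i\<in>T. u i > 0}) - int (card {i\<in>T. u i < 0})"
proof -
  have "(\<Sum>i\<in>T. isgn (u i)) = (\<Sum>i\<in>T. (if u i > 0 then 1 else 0) - (if u i < 0 then 1 else 0))"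
    by (rule sum.cong) (auto simp: isgn_def)
  also have "\<dots> = (\<Sum>i\<in>T. if u i > 0 then 1 else 0) - (\<Sum>i\<in>T. if u i < 0 then 1 else 0)"
    by (rule sum_subtractf)
  also have "\<dots> = int (card {i\<in>T. u i > 0}) - int (card {i\<in>T. u i < 0})"
    using assms by (simp add: sum.If_cases Int_def)
  finally show ?thesis .
qed

lemma perturb_signs:
  fixes u w :: "'a \<Rightarrow> real"
  assumes "finite T"
  obtains \<epsilon> where "\<epsilon> > 0" "\<And>i. i \<in> T \<Longrightarrow> u i > 0 \<Longrightarrow> u i + \<epsilon> * w i > 0"
    "\<And>i. i \<in> T \<Longrightarrow> u i < 0 \<Longrightarrow> u i + \<epsilon> * w i < 0"
proof -
  have "\<exists>\<epsilon>>0. \<forall>i\<in>T. u i \<noteq> 0 \<longrightarrow> \<epsilon> * \<bar>w i\<bar> < \<bar>u i\<bar>"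
    using assms
  proof (induction T)
    case empty
    show ?case by (rule exI[of _ 1]) auto
  next
    case (insert x F)
    then obtain \<epsilon> where e: "\<epsilon> > 0" "\<forall>i\<in>F. u i \<noteq> 0 \<longrightarrow> \<epsilon> * \<bar>w i\<bar> < \<bar>u i\<bar>" by blast
    define \<delta> where "\<delta> = (if u x = 0 then \<epsilon> else min \<epsilon> (\<bar>u x\<bar> / (\<bar>w x\<bar> + 1)))"
    have d: "\<delta> > 0" "\<delta> \<le> \<epsilon>" using e by (auto simp: \<delta>_def intro!: divide_pos_pos)
    have "\<delta> * \<bar>w i\<bar> < \<bar>u i\<bar>" if "i \<in> insert x F" "u i \<noteq> 0" for i
    proof (cases "i = x")
      case True
      then have "\<delta> \<le> \<bar>u x\<bar> / (\<bar>w x\<bar> + 1)" using that by (simp add: \<delta>_def)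
      then have "\<delta> * (\<bar>w x\<bar> + 1) \<le> \<bar>u x\<bar>" by (simp add: pos_le_divide_eq add_nonneg_pos)
      then show ?thesis using d True by (simp add: algebra_simps)
    next
      case False
      then have "\<epsilon> * \<bar>w i\<bar> < \<bar>u i\<bar>" using e that by auto
      moreover have "\<delta> * \<bar>w i\<bar> \<le> \<epsilon> * \<bar>w i\<bar>" using d by (simp add: mult_right_mono)
      ultimately show ?thesis by linarith
    qed
    then show ?case using d by blast
  qed
  then obtain \<epsilon> where e: "\<epsilon> > 0" "\<And>i. i \<in> T \<Longrightarrow> u i \<noteq> 0 \<Longrightarrow> \<epsilon> * \<bar>w i\<bar> < \<bar>u i\<bar>" by blast
  have "\<bar>\<epsilon> * w i\<bar> < \<bar>u i\<bar>" if "i \<in> T" "u i \<noteq> 0" for i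
    using e that by (simp add: abs_mult)
  then show ?thesis using e(1) by (intro that[of \<epsilon>]) fastforce+
qed

lemma signed_median:
  fixes \<theta> :: "'a \<Rightarrow> real" and \<epsilon> :: "'a \<Rightarrow> int"
  assumes fin: "finite R" and inj: "inj_on \<theta> R"
    and sgn: "\<And>i. i \<in> R \<Longrightarrow> \<bar>\<epsilon> i\<bar> = 1" and big: "2 \<le> (\<Sum>i\<in>R. \<epsilon> i)"
  obtains i where "i \<in> R" "\<bar>1 + (\<Sum>l\<in>R. \<epsilon> l * isgn (\<theta> i - \<theta> l))\<bar> \<le> 1"
proof -
  let ?S = "\<Sum>i\<in>R. \<epsilon> i"
  let ?lt = "\<lambda>i. {l\<in>R. \<theta> l < \<theta> i}" and ?le = "\<lambda>i. {l\<in>R. \<theta> l \<le> \<theta> i}"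
  let ?X = "{i\<in>R. ?S \<le> 2 * sum \<epsilon> (?le i)}"
  have ne: "R \<noteq> {}" using big by auto
  obtain m where m: "m \<in> R" "\<And>l. l \<in> R \<Longrightarrow> \<theta> l \<le> \<theta> m"
    using obtains_MAX[OF fin ne, of \<theta>] Max_ge[of "\<theta> ` R"] fin by (metis finite_imageI imageI)
  have "?le m = R" using m by auto
  then have "?X \<noteq> {}" using m big by auto
  then obtain i where i: "i \<in> ?X" "\<And>l. l \<in> ?X \<Longrightarrow> \<theta> i \<le> \<theta> l"
    using ex_is_arg_min_if_finite[of ?X \<theta>] fin by (auto simp: is_arg_min_linorder)
  have iR: "i \<in> R" using i by simp
  have less: "2 * sum \<epsilon> (?lt i) < ?S"
  proof (cases "?lt i = {}")
    case True
    have "sum \<epsilon> (?lt i) = 0" unfolding True by simp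
    then show ?thesis using big by linarith
  next
    case False
    have "finite (?lt i)" using fin by simp
    then obtain k where k: "k \<in> ?lt i" "\<And>l. l \<in> ?lt i \<Longrightarrow> \<theta> l \<le> \<theta> k"
      using False obtains_MAX[of "?lt i" \<theta>] Max_ge[of "\<theta> ` ?lt i"]
      by (metis (no_types, lifting) finite_imageI imageI)
    have "?lt i = ?le k" using k by fastforce
    moreover have "k \<notin> ?X" using i(2)[of k] k(1) by auto
    ultimately show ?thesis using k(1) by auto
  qed
  have le: "?le i = insert i (?lt i)"
    using iR inj by (auto simp: inj_on_def order_le_less)
  have sle: "sum \<epsilon> (?le i) = \<epsilon> i + sum \<epsilon> (?lt i)"
    unfolding le using fin by (subst sum.insert) auto
  have R: "R = ?le i \<union> {l\<in>R. \<theta> i < \<theta> l}" by auto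
  have "?S = sum \<epsilon> (?le i) + sum \<epsilon> {l\<in>R. \<theta> i < \<theta> l}"
    using fin by (subst R, subst sum.union_disjoint) auto
  moreover have "(\<Sum>l\<in>R. \<epsilon> l * isgn (\<theta> i - \<theta> l)) = sum \<epsilon> (?lt i) - sum \<epsilon> {l\<in>R. \<theta> i < \<theta> l}"
  proof -
    have "(\<Sum>l\<in>R. \<epsilon> l * isgn (\<theta> i - \<theta> l)) =
      (\<Sum>l\<in>R. (if \<theta> l < \<theta> i then \<epsilon> l else 0) - (if \<theta> i < \<theta> l then \<epsilon> l else 0))"
      by (rule sum.cong) (auto simp: isgn_def)
    also have "\<dots> = (\<Sum>l\<in>R. if \<theta> l < \<theta> i then \<epsilon> l else 0) - (\<Sum>l\<in>R. if \<theta> i < \<theta> l then \<epsilon> l else 0)"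
      by (rule sum_subtractf)
    finally show ?thesis using fin by (simp add: sum.If_cases Int_def)
  qed
  moreover have "?S \<le> 2 * sum \<epsilon> (?le i)" using i(1) by simp
  moreover have "\<epsilon> i = 1" using sgn[OF iR] less sle calculation by linarith
  ultimately have "\<bar>1 + (\<Sum>l\<in>R. \<epsilon> l * isgn (\<theta> i - \<theta> l))\<bar> \<le> 1"
    using less sle by linarith
  then show ?thesis using that iR by blast
qed

lemma quadratic_avoiding_zero:
  fixes X :: "(real \<times> real \<times> real) set"
  assumes "finite X" "(0, 0, 0) \<notin> X"
  obtains s where "\<And>a b c. (a, b, c) \<in> X \<Longrightarrow> a + s * b + s\<^sup>2 * c \<noteq> 0"
proof -
  let ?B = "\<Union>(a, b, c)\<in>X. {s. poly [:a, b, c:] s = 0}"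
  have "finite {s. poly [:a, b, c:] s = 0}" if "(a, b, c) \<in> X" for a b c
    using that assms(2) by (intro poly_roots_finite) auto
  then have "finite ?B" using assms(1) by (intro finite_UN_I) auto
  then obtain s where "s \<notin> ?B"
    using ex_new_if_finite[OF infinite_UNIV_char_0] by blast
  then show ?thesis by (intro that[of s]) (force simp: algebra_simps power2_eq_square)
qed

section \<open>Halving sets of rank four function spaces\<close>

text \<open>Restricted to \<open>T\<close>, such an \<open>M\<close> has dimension 4 and contains the constants, so evaluation
  at the elements of \<open>T\<close> places them as points in general position in \<open>\<real>\<^sup>3\<close>, and the sign
  patterns of \<open>M\<close> are the ways in which planes split these points.\<close>

locale uniform_rank4 =
  fixes T :: "'a set" and M :: "('a \<Rightarrow> real) set"
  assumes finite_T: "finite T" and card_T: "5 \<le> card T"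
    and lin: "\<And>a b u v. u \<in> M \<Longrightarrow> v \<in> M \<Longrightarrow> (\<lambda>i. a * u i + b * v i) \<in> M"
    and one: "(\<lambda>_. 1) \<in> M"
    and zeros: "\<And>u Q. u \<in> M \<Longrightarrow> Q \<subseteq> T \<Longrightarrow> card Q = 4 \<Longrightarrow> \<forall>i\<in>Q. u i = 0 \<Longrightarrow> \<forall>i\<in>T. u i = 0"
    and interpolation: "\<And>Q f. Q \<subseteq> T \<Longrightarrow> card Q \<le> 4 \<Longrightarrow> \<exists>u\<in>M. \<forall>i\<in>Q. u i = f i"
begin

definition halving :: "'a set \<Rightarrow> ('a \<Rightarrow> real) \<Rightarrow> bool" where
  "halving Z u \<longleftrightarrow> Z \<subseteq> T \<and> card Z = 3 \<and> u \<in> M \<and> (\<forall>i\<in>T. u i = 0 \<longleftrightarrow> i \<in> Z) \<and>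
     \<bar>\<Sum>i\<in>T. isgn (u i)\<bar> \<le> 1"

definition cell :: "'a set \<Rightarrow> ('a \<Rightarrow> real) set" where
  "cell A = {v \<in> M. \<forall>a\<in>A. \<forall>b\<in>T - A. v b \<le> v a}"

definition halves :: "'a set set" where
  "halves = {A. A \<subseteq> T \<and> card A = card T div 2 \<and>
     (\<exists>u\<in>M. (\<forall>i\<in>A. u i > 0) \<and> (\<forall>i\<in>T - A. u i < 0))}"

lemma exists_halving:
  assumes pq: "p \<in> T" "q \<in> T" "p \<noteq> q"
  obtains Z u where "halving Z u" "p \<in> Z" "q \<in> Z"
proof -
  have "card (T - {p, q}) \<ge> 3" using pq finite_T card_T by simp
  then obtain r where r: "r \<in> T - {p, q}" by (metis card.empty ex_in_conv not_numeral_le_zero)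
  have "card (T - {p, q, r}) \<ge> 2" using pq r finite_T card_T
    by (subst card_Diff_subset) (auto simp: card_insert_if)
  then obtain x where x: "x \<in> T - {p, q, r}" by (metis card.empty ex_in_conv not_numeral_le_zero)
  define R where "R = T - {p, q, r}"
  have TR: "T = insert p (insert q (insert r R))" and d: "p \<notin> R" "q \<notin> R" "r \<notin> R" "p \<noteq> r" "q \<noteq> r"
    and finR: "finite R"
    using pq r finite_T by (auto simp: R_def)
  have sumT: "(\<Sum>i\<in>T. F i) = F p + F q + F r + (\<Sum>i\<in>R. F i)" for F :: "'a \<Rightarrow> int"
    using d pq(3) finR by (simp add: TR)
  obtain e0 where e0: "e0 \<in> M" "\<forall>i\<in>{p,q,r,x}. e0 i = (if i = x then 1 else 0)"
    using interpolation[of "{p,q,r,x}" "\<lambda>i. if i = x then 1 else 0"] pq r x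
    by (auto simp: card_insert_if)
  define e where "e = (if 0 \<le> (\<Sum>i\<in>R. isgn (e0 i)) then e0 else (\<lambda>i. - e0 i))"
  have eM: "e \<in> M" using e0(1) lin[of e0 e0 "-1" 0] by (simp add: e_def)
  have e_z: "e p = 0" "e q = 0" "e r = 0" "e x \<noteq> 0" using e0 pq x r by (auto simp: e_def)
  have e_pos: "0 \<le> (\<Sum>i\<in>R. isgn (e i))" by (auto simp: e_def isgn_minus sum_negf)
  have e_nz: "e i \<noteq> 0" if "i \<in> R" for i
  proof
    assume "e i = 0"
    then have "\<forall>i\<in>T. e i = 0"
      using e_z that d pq by (intro zeros[OF eM, of "{p,q,r,i}"]) (auto simp: TR card_insert_if)
    then show False using e_z x by auto
  qed
  obtain f where f: "f \<in> M" "f p = 0" "f q = 0" "f r = 1"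
    using interpolation[of "{p,q,r}" "\<lambda>i. if i = r then 1 else 0"] pq r
    by (auto simp: card_insert_if)
  define \<theta> where "\<theta> i = - f i / e i" for i
  define g where "g i = (\<lambda>l. f l + \<theta> i * e l)" for i
  have gM: "g i \<in> M" for i using lin[OF f(1) eM, of 1 "\<theta> i"] by (simp add: g_def)
  have g_r: "g i p = 0" "g i q = 0" "g i r = 1" for i by (auto simp: g_def f e_z)
  have g_eq: "g i l = e l * (\<theta> i - \<theta> l)" if "l \<in> R" for i l
    using e_nz[OF that] by (simp add: g_def \<theta>_def field_simps)
  have g_nz: "g i l \<noteq> 0" if "i \<in> R" "l \<in> R" "i \<noteq> l" for i l
  proof
    assume "g i l = 0"
    then have "\<forall>k\<in>T. g i k = 0"
      using g_r[of i] that d pq g_eq[of i i]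
      by (intro zeros[OF gM, of "{p,q,i,l}"]) (auto simp: TR card_insert_if)
    then show False using g_r[of i] r by auto
  qed
  then have inj: "inj_on \<theta> R" using g_eq by (force simp: inj_on_def)
  show ?thesis
  proof (cases "2 \<le> (\<Sum>i\<in>R. isgn (e i))")
    case False
    have "halving {p, q, r} e"
      unfolding halving_def sumT using e_z e_nz e_pos False eM d pq(3)
      by (auto simp: TR isgn_def[of 0])
    then show ?thesis using that by blast
  next
    case True
    have "\<bar>isgn (e i)\<bar> = 1" if "i \<in> R" for i using e_nz[OF that] by (auto simp: isgn_def)
    then obtain i where i: "i \<in> R" "\<bar>1 + (\<Sum>l\<in>R. isgn (e l) * isgn (\<theta> i - \<theta> l))\<bar> \<le> 1"
      using signed_median[OF finR inj _ True] by blast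
    have "(\<Sum>l\<in>T. isgn (g i l)) = 1 + (\<Sum>l\<in>R. isgn (e l) * isgn (\<theta> i - \<theta> l))"
      unfolding sumT by (simp add: g_r isgn_def[of 0] isgn_def[of 1] g_eq isgn_mult)
    moreover have "g i i = 0" using g_eq i by simp
    ultimately have "halving {p, q, i} (g i)"
      unfolding halving_def using i g_r[of i] g_nz[of i] gM pq d
      by (auto simp: TR card_insert_if)
    then show ?thesis using that by blast
  qed
qed

lemma card_halving_triples:
  "card T choose 2 \<le> 3 * card {Z. \<exists>u. halving Z u}"
proof -
  let ?H = "{Z. \<exists>u. halving Z u}"
  have finH: "finite ?H"
    by (rule finite_subset[of _ "Pow T"]) (auto simp: halving_def finite_T)
  have sub: "{B. B \<subseteq> T \<and> card B = 2} \<subseteq> (\<Union>Z\<in>?H. {B. B \<subseteq> Z \<and> card B = 2})"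
  proof
    fix B assume "B \<in> {B. B \<subseteq> T \<and> card B = 2}"
    then obtain p q where "B = {p, q}" "p \<in> T" "q \<in> T" "p \<noteq> q"
      by (auto simp: card_2_iff)
    moreover then obtain Z u where "halving Z u" "p \<in> Z" "q \<in> Z" using exists_halving by blast
    ultimately have "Z \<in> ?H" "B \<in> {B. B \<subseteq> Z \<and> card B = 2}" by auto
    then show "B \<in> (\<Union>Z\<in>?H. {B. B \<subseteq> Z \<and> card B = 2})" by blast
  qed
  have Z: "finite Z \<and> card {B. B \<subseteq> Z \<and> card B = 2} = 3" if "Z \<in> ?H" for Z
  proof -
    have "finite Z" "card Z = 3" using that finite_T by (auto simp: halving_def intro: finite_subset)
    then show ?thesis by (simp add: n_subsets numeral_eq_Suc)
  qed
  have "card T choose 2 = card {B. B \<subseteq> T \<and> card B = 2}" by (simp add: n_subsets finite_T)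
  also have "\<dots> \<le> card (\<Union>Z\<in>?H. {B. B \<subseteq> Z \<and> card B = 2})"
    by (rule card_mono[OF _ sub]) (use finH Z in auto)
  also have "\<dots> \<le> (\<Sum>Z\<in>?H. card {B. B \<subseteq> Z \<and> card B = 2})" by (rule card_UN_le[OF finH])
  also have "\<dots> = 3 * card ?H" using Z by simp
  finally show ?thesis .
qed

lemma halving_cards:
  assumes "halving Z u"
  shows "card T = card {i\<in>T. u i > 0} + card {i\<in>T. u i < 0} + 3"
    and "card {i\<in>T. u i > 0} \<le> card {i\<in>T. u i < 0} + 1"
    and "card {i\<in>T. u i < 0} \<le> card {i\<in>T. u i > 0} + 1"
proof -
  have "T = {i\<in>T. u i > 0} \<union> {i\<in>T. u i < 0} \<union> Z" using assms by (auto simp: halving_def)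
  then have "card T = card ({i\<in>T. u i > 0} \<union> {i\<in>T. u i < 0} \<union> Z)" by simp
  also have "\<dots> = card ({i\<in>T. u i > 0} \<union> {i\<in>T. u i < 0}) + card Z"
    using assms finite_T by (intro card_Un_disjoint) (auto simp: halving_def intro: finite_subset)
  also have "card ({i\<in>T. u i > 0} \<union> {i\<in>T. u i < 0}) = card {i\<in>T. u i > 0} + card {i\<in>T. u i < 0}"
    using finite_T by (intro card_Un_disjoint) auto
  finally show "card T = card {i\<in>T. u i > 0} + card {i\<in>T. u i < 0} + 3"
    using assms by (simp add: halving_def)
  have "\<bar>int (card {i\<in>T. u i > 0}) - int (card {i\<in>T. u i < 0})\<bar> \<le> 1"
    using assms by (simp add: halving_def sum_isgn[OF finite_T])
  then show "card {i\<in>T. u i > 0} \<le> card {i\<in>T. u i < 0} + 1"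
    and "card {i\<in>T. u i < 0} \<le> card {i\<in>T. u i > 0} + 1" by linarith+
qed

lemma halving_scale:
  assumes "halving Z u" "c \<noteq> 0"
  shows "halving Z (\<lambda>i. c * u i)"
proof -
  have "(\<lambda>i. c * u i) \<in> M" using lin[of u u c 0] assms by (simp add: halving_def)
  moreover have "\<bar>isgn c\<bar> = 1" using assms by (simp add: isgn_def)
  ultimately show ?thesis
    using assms by (auto simp: halving_def isgn_mult sum_distrib_left[symmetric] abs_mult)
qed

lemma halving_translate_unique:
  assumes h: "halving Z u" and h': "halving Z' u'" and eq: "\<And>i. i \<in> T \<Longrightarrow> u' i = u i + c"
  shows "Z = Z'"
proof (cases "c = 0")
  case True
  then show ?thesis using assms by (auto simp: halving_def)
next
  case False
  have Z: "card Z = 3" "Z \<subseteq> T" "card Z' = 3" "Z' \<subseteq> T"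
    and u: "\<And>i. i \<in> Z \<Longrightarrow> u i = 0" "\<And>i. i \<in> Z' \<Longrightarrow> u' i = 0"
    using h h' by (auto simp: halving_def)
  have fin: "finite Z" "finite Z'" using Z finite_T finite_subset by blast+
  consider "c > 0" | "c < 0" using False by linarith
  then show ?thesis
  proof cases
    case 1
    have "Z \<union> {i\<in>T. u i > 0} \<subseteq> {i\<in>T. u' i > 0}" using Z u 1 eq by auto
    then have "card (Z \<union> {i\<in>T. u i > 0}) \<le> card {i\<in>T. u' i > 0}"
      using finite_T by (intro card_mono) auto
    moreover have "card (Z \<union> {i\<in>T. u i > 0}) = card Z + card {i\<in>T. u i > 0}"
      using finite_T fin u by (intro card_Un_disjoint) auto
    ultimately show ?thesis
      using halving_cards[OF h] halving_cards[OF h'] Z by linarith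
  next
    case 2
    have "Z \<union> {i\<in>T. u i < 0} \<subseteq> {i\<in>T. u' i < 0}" using Z u 2 eq by auto
    then have "card (Z \<union> {i\<in>T. u i < 0}) \<le> card {i\<in>T. u' i < 0}"
      using finite_T by (intro card_mono) auto
    moreover have "card (Z \<union> {i\<in>T. u i < 0}) = card Z + card {i\<in>T. u i < 0}"
      using finite_T fin u by (intro card_Un_disjoint) auto
    ultimately show ?thesis
      using halving_cards[OF h] halving_cards[OF h'] Z by linarith
  qed
qed

text \<open>On \<open>M\<close> the functional \<open>\<psi>\<close> is a combination of the evaluations at the three elements of \<open>Z\<close>,
  with coefficients that sum to 0. Two of them have the same weak sign; putting the third element
  on the appropriate side of the plane gives the cell on which \<open>\<psi>\<close> has constant sign.\<close>

lemma halving_is_cell_optimum: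
  fixes \<psi> :: "('a \<Rightarrow> real) \<Rightarrow> real"
  assumes h: "halving Z u"
    and \<psi>_lin: "\<And>a b v w. \<psi> (\<lambda>i. a * v i + b * w i) = a * \<psi> v + b * \<psi> w"
    and \<psi>_T: "\<And>v w. (\<And>i. i \<in> T \<Longrightarrow> v i = w i) \<Longrightarrow> \<psi> v = \<psi> w"
    and \<psi>_1: "\<psi> (\<lambda>_. 1) = 0" and \<psi>_u: "\<psi> u = 0"
  shows "\<exists>A\<in>halves. u \<in> cell A \<and> ((\<forall>v\<in>cell A. 0 \<le> \<psi> v) \<or> (\<forall>v\<in>cell A. \<psi> v \<le> 0))"
proof -
  have ZT: "Z \<subseteq> T" and c3: "card Z = 3" and uM: "u \<in> M" and uz: "\<And>i. i \<in> T \<Longrightarrow> u i = 0 \<longleftrightarrow> i \<in> Z"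
    using h by (auto simp: halving_def)
  have finZ: "finite Z" using ZT finite_T finite_subset by blast
  obtain p q r where Z: "Z = {p, q, r}" and d: "p \<noteq> q" "p \<noteq> r" "q \<noteq> r"
    using c3 by (auto simp: card_3_iff)
  have "card (T - Z) > 0" using ZT finZ card_T c3 by (simp add: card_Diff_subset)
  then obtain x where x: "x \<in> T" "x \<notin> Z" by (metis Diff_iff card_gt_0_iff ex_in_conv)
  have "\<exists>w\<in>M. \<forall>i\<in>Z. w i = (if i = z then 1 else 0)" for z
    using interpolation[of Z "\<lambda>i. if i = z then 1 else 0"] ZT c3 by auto
  then obtain E where EM: "\<And>z. E z \<in> M" and E: "\<And>z i. i \<in> Z \<Longrightarrow> E z i = (if i = z then 1 else 0)"
    by metis
  define k where "k z = \<psi> (E z)" for z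
  have \<psi>_eq: "\<psi> v = k p * v p + k q * v q + k r * v r" if v: "v \<in> M" for v
  proof -
    define w where "w = (\<lambda>i. 1 * v i + (-1) * (v p * E p i + 1 * (v q * E q i + v r * E r i)))"
    have wM: "w \<in> M" unfolding w_def by (intro lin v EM)
    define w' where "w' = (\<lambda>i. 1 * w i + (- w x / u x) * u i)"
    have w'M: "w' \<in> M" unfolding w'_def by (intro lin wM uM)
    have "\<forall>i\<in>T. w' i = 0"
    proof (rule zeros[OF w'M])
      show "insert x Z \<subseteq> T" "card (insert x Z) = 4" using x ZT c3 finZ by auto
      have "u x \<noteq> 0" using uz x by auto
      then show "\<forall>i\<in>insert x Z. w' i = 0"
        using d uz ZT by (auto simp: w'_def w_def Z E)
    qed
    then have "\<psi> w' = \<psi> (\<lambda>i. 0 * u i + 0 * u i)" by (intro \<psi>_T) auto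
    then have "\<psi> w' = 0" by (simp only: \<psi>_lin)
    then have "\<psi> w = 0" unfolding w'_def \<psi>_lin \<psi>_u by simp
    then show ?thesis unfolding w_def \<psi>_lin k_def by (simp add: algebra_simps)
  qed
  have k0: "k p + k q + k r = 0" using \<psi>_eq[OF one] \<psi>_1 by simp
  have "\<exists>z\<in>Z. (\<forall>y\<in>Z - {z}. k y \<le> 0) \<or> (\<forall>y\<in>Z - {z}. 0 \<le> k y)"
    using d by (auto simp: Z)
  then obtain z where z: "z \<in> Z" and kz: "(\<forall>y\<in>Z - {z}. k y \<le> 0) \<or> (\<forall>y\<in>Z - {z}. 0 \<le> k y)" by blast
  have \<psi>_z: "\<psi> v = (\<Sum>y\<in>Z - {z}. k y * (v y - v z))" if v: "v \<in> M" for v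
  proof -
    have "\<psi> v = (\<Sum>y\<in>Z. k y * v y)" using \<psi>_eq[OF v] d by (simp add: Z)
    also have "\<dots> = (\<Sum>y\<in>Z. k y * v y) - (\<Sum>y\<in>Z. k y) * v z" using k0 d by (simp add: Z)
    also have "\<dots> = (\<Sum>y\<in>Z. k y * (v y - v z))"
      by (simp add: sum_distrib_right sum_subtractf right_diff_distrib)
    also have "\<dots> = (\<Sum>y\<in>Z - {z}. k y * (v y - v z))"
      using finZ z by (simp add: sum.remove)
    finally show ?thesis .
  qed
  let ?pos = "{i\<in>T. u i > 0}"
  have "card T div 2 = card ?pos + 1 \<or> card T div 2 = card ?pos + 2"
    using halving_cards[OF h] by linarith
  moreover have card_rest: "card (Z - {z}) = 2" using z c3 finZ by simp
  ultimately obtain B where B: "B = {z} \<or> B = Z - {z}" "card T div 2 = card ?pos + card B"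
    using z c3 finZ card_rest by (metis is_singletonI is_singleton_altdef)
  have BZ: "B \<subseteq> Z" "finite B" using B z finZ by auto
  define A where "A = ?pos \<union> B"
  have AT: "A \<subseteq> T" using BZ ZT by (auto simp: A_def)
  have cA: "card A = card T div 2"
    unfolding A_def B(2) using BZ finite_T ZT uz by (intro card_Un_disjoint) force+
  obtain w where w: "w \<in> M" "\<forall>i\<in>Z. w i = (if i \<in> B then 1 else - 1)"
    using interpolation[of Z "\<lambda>i. if i \<in> B then 1 else - 1"] ZT c3 by auto
  obtain \<epsilon> where e: "\<epsilon> > 0" "\<And>i. i \<in> T \<Longrightarrow> u i > 0 \<Longrightarrow> u i + \<epsilon> * w i > 0"
    "\<And>i. i \<in> T \<Longrightarrow> u i < 0 \<Longrightarrow> u i + \<epsilon> * w i < 0"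
    using perturb_signs[OF finite_T] by metis
  have "(\<lambda>i. 1 * u i + \<epsilon> * w i) \<in> M" by (intro lin uM w)
  moreover have "1 * u i + \<epsilon> * w i > 0" if "i \<in> A" for i
  proof (cases "u i > 0")
    case True
    then show ?thesis using e that AT by auto
  next
    case False
    then have "i \<in> B" using that by (auto simp: A_def)
    moreover then have "u i = 0" using uz BZ ZT by blast
    ultimately show ?thesis using w e BZ by auto
  qed
  moreover have "1 * u i + \<epsilon> * w i < 0" if "i \<in> T - A" for i
  proof (cases "u i < 0")
    case True
    then show ?thesis using e that by auto
  next
    case False
    then have "u i = 0" using that by (auto simp: A_def)
    then have "i \<in> Z" "i \<notin> B" using that uz by (auto simp: A_def)
    then show ?thesis using w e \<open>u i = 0\<close> by auto
  qed
  ultimately have "A \<in> halves"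
    unfolding halves_def mem_Collect_eq using AT cA
    by (intro conjI bexI[of _ "\<lambda>i. 1 * u i + \<epsilon> * w i"] ballI)
  moreover have "u \<in> cell A"
  proof -
    have "u b \<le> u a" if "a \<in> A" "b \<in> T - A" for a b
    proof -
      have "u b \<le> 0" using that by (auto simp: A_def)
      moreover have "u a \<ge> 0" using that uz BZ ZT by (force simp: A_def)
      ultimately show ?thesis by linarith
    qed
    then show ?thesis using uM by (auto simp: cell_def)
  qed
  moreover have "(\<forall>v\<in>cell A. 0 \<le> \<psi> v) \<or> (\<forall>v\<in>cell A. \<psi> v \<le> 0)"
  proof -
    have inA: "i \<in> A \<longleftrightarrow> i \<in> B" if "i \<in> Z" for i using that uz ZT by (force simp: A_def)
    have split: "(\<forall>v\<in>cell A. \<forall>y\<in>Z-{z}. v y - v z \<le> 0) \<or> (\<forall>v\<in>cell A. \<forall>y\<in>Z-{z}. v y - v z \<ge> 0)"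
      using B(1)
    proof
      assume "B = {z}"
      then have "v y \<le> v z" if "v \<in> cell A" "y \<in> Z - {z}" for v y
        using that inA z ZT by (auto simp: cell_def)
      then show ?thesis by auto
    next
      assume "B = Z - {z}"
      then have "v z \<le> v y" if "v \<in> cell A" "y \<in> Z - {z}" for v y
        using that inA z ZT by (auto simp: cell_def)
      then show ?thesis by auto
    qed
    have M: "v \<in> M" if "v \<in> cell A" for v using that by (simp add: cell_def)
    show ?thesis using split kz
      by (elim disjE) (auto simp: \<psi>_z[OF M] intro!: sum_nonneg sum_nonpos
          intro: mult_nonneg_nonneg mult_nonpos_nonpos mult_nonneg_nonpos mult_nonpos_nonneg)
  qed
  ultimately show ?thesis by blast
qed

lemma card_halves: "card T choose 2 \<le> 6 * card halves"
proof -
  define H where "H = {Z. \<exists>u. halving Z u}"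
  have finH: "finite H"
    unfolding H_def by (rule finite_subset[of _ "Pow T"]) (auto simp: halving_def finite_T)
  obtain X where X: "X \<subseteq> T" "card X = 4"
    by (rule obtain_subset_with_card_n[of 4 T]) (use card_T in auto)
  then have "card X = Suc 3" by simp
  then obtain x0 X' where "X = insert x0 X'" "card X' = 3" by (metis card_Suc_eq)
  then obtain x1 x2 x3 where Xeq: "X = {x0, x1, x2, x3}" by (auto simp: card_3_iff)
  \<comment> \<open>Generic functionals \<open>G s\<close>, \<open>G s'\<close> that vanish on constants: the quotient \<open>G s' / G s\<close> is
    defined and takes different values at different halving planes, and each of these planes is the
    minimum or the maximum of the quotient on an adjacent cell.\<close>
  define G where "G s u = (u x1 - u x0) + s * (u x2 - u x0) + s\<^sup>2 * (u x3 - u x0)"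
    for s :: real and u :: "'a \<Rightarrow> real"
  define tr where "tr u = (u x1 - u x0, u x2 - u x0, u x3 - u x0)" for u :: "'a \<Rightarrow> real"
  have G_lin: "G s (\<lambda>i. a * v i + b * w i) = a * G s v + b * G s w" for s a b v w
    by (simp add: G_def algebra_simps)
  have G_1: "G s (\<lambda>_. 1) = 0" for s by (simp add: G_def)
  have G_T: "G s v = G s w" if "\<And>i. i \<in> T \<Longrightarrow> v i = w i" for s v w
    using that X Xeq by (simp add: G_def)
  have const: "\<forall>i\<in>T. u i = u x0" if "u \<in> M" "tr u = (0, 0, 0)" for u
  proof -
    have "\<forall>i\<in>T. (\<lambda>i. 1 * u i + (- u x0) * 1) i = 0"
      using that X by (intro zeros[of _ X] lin one) (auto simp: Xeq tr_def)
    then show ?thesis by simp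
  qed
  have "\<forall>Z\<in>H. \<exists>u. halving Z u" by (simp add: H_def)
  from bchoice[OF this] obtain u0 where u0: "\<And>Z. Z \<in> H \<Longrightarrow> halving Z (u0 Z)" by auto
  have tr0: "tr (u0 Z) \<noteq> (0, 0, 0)" if "Z \<in> H" for Z
  proof
    assume "tr (u0 Z) = (0, 0, 0)"
    then have c: "\<forall>i\<in>T. u0 Z i = u0 Z x0" using const u0[OF that] by (auto simp: halving_def)
    have Z: "Z \<subseteq> T" "card Z = 3" "\<And>i. i \<in> T \<Longrightarrow> u0 Z i = 0 \<longleftrightarrow> i \<in> Z"
      using u0[OF that] by (auto simp: halving_def)
    then obtain z where "z \<in> Z" by fastforce
    then have "u0 Z x0 = 0" using c Z by (metis subsetD)
    then have "T \<subseteq> Z" using c Z(3) by auto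
    then have "Z = T" using Z(1) by auto
    then show False using Z(2) card_T by simp
  qed
  have "finite ((tr \<circ> u0) ` H)" "(0, 0, 0) \<notin> (tr \<circ> u0) ` H" using finH tr0 by force+
  then obtain s where s: "\<And>a b c. (a, b, c) \<in> (tr \<circ> u0) ` H \<Longrightarrow> a + s * b + s\<^sup>2 * c \<noteq> 0"
    using quadratic_avoiding_zero by blast
  have G0: "G s (u0 Z) \<noteq> 0" if "Z \<in> H" for Z
    using s[of "u0 Z x1 - u0 Z x0" "u0 Z x2 - u0 Z x0" "u0 Z x3 - u0 Z x0"] that
    by (force simp: G_def tr_def)
  define U where "U Z = (\<lambda>i. (1 / G s (u0 Z)) * u0 Z i)" for Z
  have hU: "halving Z (U Z)" if "Z \<in> H" for Z
    unfolding U_def using G0[OF that] by (intro halving_scale u0 that) auto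
  have GU: "G s (U Z) = 1" if "Z \<in> H" for Z
    using G_lin[of s "1 / G s (u0 Z)" "u0 Z" 0 "u0 Z"] G0[OF that] by (simp add: U_def)
  define D where "D = (\<lambda>(Z, Z') i. 1 * U Z i + (-1) * U Z' i)"
  define HH where "HH = {(Z, Z'). Z \<in> H \<and> Z' \<in> H \<and> Z \<noteq> Z'}"
  have finHH: "finite HH" by (rule finite_subset[of _ "H \<times> H"]) (auto simp: HH_def finH)
  have trD: "tr (D ZZ) \<noteq> (0, 0, 0)" if ZZ: "ZZ \<in> HH" for ZZ
  proof
    obtain Z Z' where Z: "ZZ = (Z, Z')" "Z \<in> H" "Z' \<in> H" "Z \<noteq> Z'" using ZZ by (auto simp: HH_def)
    assume t0: "tr (D ZZ) = (0, 0, 0)"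
    have "U Z \<in> M" "U Z' \<in> M" using hU Z by (auto simp: halving_def)
    then have "D ZZ \<in> M" using lin[of "U Z" "U Z'" 1 "-1"] by (simp add: D_def Z)
    from const[OF this t0] have "U Z i = U Z' i + D ZZ x0" if "i \<in> T" for i
      using that by (force simp: Z D_def)
    then show False using halving_translate_unique[OF hU hU, of Z' Z] Z by blast
  qed
  have "finite ((tr \<circ> D) ` HH)" "(0, 0, 0) \<notin> (tr \<circ> D) ` HH" using finHH trD by force+
  then obtain s' where s': "\<And>a b c. (a, b, c) \<in> (tr \<circ> D) ` HH \<Longrightarrow> a + s' * b + s'\<^sup>2 * c \<noteq> 0"
    using quadratic_avoiding_zero by blast
  define \<sigma> where "\<sigma> Z = G s' (U Z)" for Z
  have \<sigma>_inj: "\<sigma> Z \<noteq> \<sigma> Z'" if "Z \<in> H" "Z' \<in> H" "Z \<noteq> Z'" for Z Z'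
  proof -
    have "tr (D (Z, Z')) \<in> (tr \<circ> D) ` HH" using that by (auto simp: HH_def)
    then have "G s' (D (Z, Z')) \<noteq> 0" using s' by (simp add: tr_def G_def)
    then show ?thesis using G_lin[of s' 1 "U Z" "-1" "U Z'"] by (simp add: D_def \<sigma>_def)
  qed
  define \<psi> where "\<psi> Z v = G s' v - \<sigma> Z * G s v" for Z v
  have "\<exists>A\<in>halves. U Z \<in> cell A \<and> ((\<forall>v\<in>cell A. 0 \<le> \<psi> Z v) \<or> (\<forall>v\<in>cell A. \<psi> Z v \<le> 0))"
    if "Z \<in> H" for Z
  proof (rule halving_is_cell_optimum[OF hU[OF that]])
    show "\<psi> Z (\<lambda>i. a * v i + b * w i) = a * \<psi> Z v + b * \<psi> Z w" for a b v w
      unfolding \<psi>_def G_lin by (simp add: algebra_simps)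
    show "\<psi> Z v = \<psi> Z w" if "\<And>i. i \<in> T \<Longrightarrow> v i = w i" for v w
      using G_T[of v w, OF that] by (simp add: \<psi>_def)
    show "\<psi> Z (\<lambda>_. 1) = 0" by (simp add: \<psi>_def G_1)
    show "\<psi> Z (U Z) = 0" using GU[OF that] by (simp add: \<psi>_def \<sigma>_def)
  qed
  then have "\<forall>Z\<in>H. \<exists>A. A \<in> halves \<and> U Z \<in> cell A \<and>
      ((\<forall>v\<in>cell A. 0 \<le> \<psi> Z v) \<or> (\<forall>v\<in>cell A. \<psi> Z v \<le> 0))" by blast
  from bchoice[OF this] obtain A where A: "\<And>Z. Z \<in> H \<Longrightarrow> A Z \<in> halves"
    "\<And>Z. Z \<in> H \<Longrightarrow> U Z \<in> cell (A Z)"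
    "\<And>Z. Z \<in> H \<Longrightarrow> (\<forall>v\<in>cell (A Z). 0 \<le> \<psi> Z v) \<or> (\<forall>v\<in>cell (A Z). \<psi> Z v \<le> 0)"
    by auto
  define b where "b Z \<longleftrightarrow> (\<forall>v\<in>cell (A Z). 0 \<le> \<psi> Z v)" for Z
  have "inj_on (\<lambda>Z. (A Z, b Z)) H"
  proof (rule inj_onI, rule ccontr)
    fix Z Z' assume Z: "Z \<in> H" "Z' \<in> H" "(A Z, b Z) = (A Z', b Z')" "Z \<noteq> Z'"
    have e: "\<psi> Z (U Z') = \<sigma> Z' - \<sigma> Z" "\<psi> Z' (U Z) = \<sigma> Z - \<sigma> Z'"
      using GU Z by (auto simp: \<psi>_def \<sigma>_def)
    have "U Z \<in> cell (A Z')" "U Z' \<in> cell (A Z)" using A(2)[of Z] A(2)[of Z'] Z by auto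
    moreover have "b Z = b Z'" using Z by simp
    ultimately have "\<sigma> Z = \<sigma> Z'"
      using A(3)[OF Z(1)] A(3)[OF Z(2)] e unfolding b_def by (smt (verit))
    then show False using \<sigma>_inj Z by blast
  qed
  moreover have "(\<lambda>Z. (A Z, b Z)) ` H \<subseteq> halves \<times> UNIV" using A(1) by auto
  moreover have fin: "finite (halves \<times> (UNIV :: bool set))"
    using finite_subset[of halves "Pow T"] finite_T by (auto simp: halves_def)
  ultimately have "card H \<le> card (halves \<times> (UNIV :: bool set))"
    by (rule card_inj_on_le)
  then have "card H \<le> 2 * card halves" by (simp add: card_cartesian_product)
  then show ?thesis using card_halving_triples unfolding H_def by linarith
qed

end

section \<open>Affine dependencies and the geometry of the drawing\<close>

lemma homogeneous_system_nontrivial: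
  fixes a :: "'i \<Rightarrow> 'j \<Rightarrow> real"
  assumes "finite I" "finite J" "card I < card J"
  shows "\<exists>x. (\<exists>j\<in>J. x j \<noteq> 0) \<and> (\<forall>i\<in>I. (\<Sum>j\<in>J. a i j * x j) = 0)"
  using assms
proof (induction I arbitrary: J a rule: finite_induct)
  case empty
  then obtain j where "j \<in> J" by fastforce
  then show ?case by (intro exI[of _ "\<lambda>_. 1"]) auto
next
  case (insert k I)
  show ?case
  proof (cases "\<forall>j\<in>J. a k j = 0")
    case True
    have "card I < card J" using insert by simp
    from insert.IH[OF insert.prems(1) this, of a] show ?thesis using True by auto
  next
    case False
    then obtain m where m: "m \<in> J" "a k m \<noteq> 0" by blast
    have "card I < card (J - {m})" using insert m by simp
    from insert.IH[OF _ this, of "\<lambda>i j. a i j - a i m * a k j / a k m"] insert.prems(1)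
    obtain x where x: "\<exists>j\<in>J - {m}. x j \<noteq> 0"
      "\<forall>i\<in>I. (\<Sum>j\<in>J - {m}. (a i j - a i m * a k j / a k m) * x j) = 0" by auto
    define s where "s = (\<Sum>j\<in>J - {m}. a k j * x j)"
    define y where "y = x(m := - s / a k m)"
    have sum_y: "(\<Sum>j\<in>J. a i j * y j) = - a i m * s / a k m + (\<Sum>j\<in>J - {m}. a i j * x j)" for i
    proof -
      have "(\<Sum>j\<in>J. a i j * y j) = a i m * y m + (\<Sum>j\<in>J - {m}. a i j * y j)"
        using m insert.prems(1) by (simp add: sum.remove)
      moreover have "(\<Sum>j\<in>J - {m}. a i j * y j) = (\<Sum>j\<in>J - {m}. a i j * x j)"
        by (rule sum.cong) (auto simp: y_def)
      ultimately show ?thesis by (simp add: y_def)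
    qed
    have "(\<Sum>j\<in>J. a i j * y j) = 0" if "i \<in> insert k I" for i
    proof (cases "i = k")
      case True
      then show ?thesis unfolding sum_y using m by (simp add: s_def)
    next
      case False
      then have "0 = (\<Sum>j\<in>J - {m}. (a i j - a i m * a k j / a k m) * x j)" using x that by auto
      also have "\<dots> = (\<Sum>j\<in>J - {m}. a i j * x j) - (\<Sum>j\<in>J - {m}. (a i m / a k m) * (a k j * x j))"
        by (simp add: left_diff_distrib sum_subtractf mult.assoc)
      also have "\<dots> = (\<Sum>j\<in>J. a i j * y j)"
        unfolding sum_y sum_distrib_left[symmetric] s_def by simp
      finally show ?thesis by simp
    qed
    moreover have "\<exists>j\<in>J. y j \<noteq> 0" using x(1) by (auto simp: y_def)
    ultimately show ?thesis by blast
  qed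
qed

lemma lookup_scaleR: "Poly_Mapping.lookup (c *\<^sub>R x) k = c * Poly_Mapping.lookup x k"
  for x :: "'a \<Rightarrow>\<^sub>0 real"
proof -
  have "finite {i. c * Poly_Mapping.lookup x i \<noteq> 0}"
    by (rule finite_subset[OF _ finite_keys[of x]]) (auto simp: in_keys_iff)
  then show ?thesis by (simp add: scaleR_poly_mapping_def)
qed

lemma lookup_lincomb:
  "Poly_Mapping.lookup (\<Sum>i\<in>A. u i *\<^sub>R p i) k = (\<Sum>i\<in>A. u i * Poly_Mapping.lookup (p i) k)"
  for p :: "'i \<Rightarrow> 'a \<Rightarrow>\<^sub>0 real"
  by (induction A rule: infinite_finite_induct) (auto simp: lookup_add lookup_scaleR)

lemma continuous_on_lookup: "continuous_on S (\<lambda>x :: 'a \<Rightarrow>\<^sub>0 real. Poly_Mapping.lookup x k)"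
proof -
  have "dist (Poly_Mapping.lookup x k) (Poly_Mapping.lookup y k) \<le> 1 * dist x y" for x y :: "'a \<Rightarrow>\<^sub>0 real"
  proof (cases "k \<in> Poly_Mapping.keys x \<union> Poly_Mapping.keys y")
    case True
    then show ?thesis
      unfolding dist_poly_mapping_def mult_1
      by (intro member_le_sum[of k _ "\<lambda>n. dist (Poly_Mapping.lookup x n) (Poly_Mapping.lookup y n)"]) auto
  next
    case False
    then show ?thesis by (simp add: in_keys_iff)
  qed
  then have "1-lipschitz_on S (\<lambda>x :: 'a \<Rightarrow>\<^sub>0 real. Poly_Mapping.lookup x k)"
    by (intro lipschitz_onI) auto
  then show ?thesis by (rule lipschitz_on_continuous_on)
qed

lemma convex_hull_indexed:
  fixes p :: "'i \<Rightarrow> 'v::real_vector"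
  assumes "finite A" "inj_on p A"
  shows "convex hull (p ` A) = {y. \<exists>u. (\<forall>i\<in>A. 0 \<le> u i) \<and> sum u A = 1 \<and> (\<Sum>i\<in>A. u i *\<^sub>R p i) = y}"
proof (intro set_eqI iffI)
  fix y assume "y \<in> convex hull (p ` A)"
  then obtain u where "\<forall>x\<in>p ` A. 0 \<le> u x" "sum u (p ` A) = 1" "(\<Sum>x\<in>p ` A. u x *\<^sub>R x) = y"
    using assms by (auto simp: convex_hull_finite)
  then show "y \<in> {y. \<exists>u. (\<forall>i\<in>A. 0 \<le> u i) \<and> sum u A = 1 \<and> (\<Sum>i\<in>A. u i *\<^sub>R p i) = y}"
    using assms by (auto simp: sum.reindex intro!: exI[of _ "u \<circ> p"])
next
  fix y assume "y \<in> {y. \<exists>u. (\<forall>i\<in>A. 0 \<le> u i) \<and> sum u A = 1 \<and> (\<Sum>i\<in>A. u i *\<^sub>R p i) = y}"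
  then obtain u where u: "\<forall>i\<in>A. 0 \<le> u i" "sum u A = 1" "(\<Sum>i\<in>A. u i *\<^sub>R p i) = y" by blast
  show "y \<in> convex hull (p ` A)"
    unfolding u(3)[symmetric]
    by (rule convex_sum) (use u assms in \<open>auto intro: hull_inc\<close>)
qed

lemma affine_hull_indexed:
  fixes p :: "'i \<Rightarrow> 'v::real_vector"
  assumes "finite A" "inj_on p A" "y \<in> affine hull (p ` A)"
  obtains u where "sum u A = 1" "(\<Sum>i\<in>A. u i *\<^sub>R p i) = y"
proof -
  obtain u where "sum u (p ` A) = 1" "(\<Sum>x\<in>p ` A. u x *\<^sub>R x) = y"
    using assms by (auto simp: affine_hull_finite)
  then show ?thesis
    using assms by (intro that[of "u \<circ> p"]) (auto simp: sum.reindex)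
qed

lemma polytope_eq_hull_vertices:
  assumes "polytope P"
  shows "P = convex hull (polytope_vertices P)"
proof -
  obtain W0 where W0: "finite W0" "P = convex hull W0" using assms by (auto simp: polytope_def)
  obtain W where W: "finite W" "P = convex hull W"
    and min: "\<And>W'. finite W' \<and> P = convex hull W' \<Longrightarrow> card W \<le> card W'"
    using W0 ex_has_least_nat[of "\<lambda>W. finite W \<and> P = convex hull W" W0 card] by blast
  have "w extreme_point_of P" if "w \<in> W" for w
  proof -
    have "w \<notin> convex hull (W - {w})"
    proof
      assume "w \<in> convex hull (W - {w})"
      then have "convex hull (W - {w}) = P"
        using W(2) hull_redundant[of w convex "W - {w}"] that by (simp add: insert_absorb)
      then show False using min[of "W - {w}"] W(1) that
        by (metis card_Diff1_less finite_Diff leD)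
    qed
    then have "w extreme_point_of (convex hull (insert w (W - {w})))"
      using W(1) by (intro extreme_point_of_convex_hull_insert) auto
    then show ?thesis using W(2) that by (simp add: insert_absorb)
  qed
  moreover have "v \<in> W" if "v extreme_point_of P" for v
    using that W(2) extreme_point_of_convex_hull by blast
  ultimately have "polytope_vertices P = W" by (auto simp: polytope_vertices_def)
  then show ?thesis using W(2) by simp
qed

locale drawing =
  fixes n d :: nat and p :: "nat \<Rightarrow> point"
  assumes drawing: "rectilinear_drawing n d p" and large: "d + 1 \<le> n"
begin

text \<open>Homogeneous coordinates: index \<open>d\<close> carries the constant 1.\<close>

definition coord :: "nat \<Rightarrow> nat \<Rightarrow> real" where
  "coord i k = (if k = d then 1 else Poly_Mapping.lookup (p i) k)"

definition dep :: "(nat \<Rightarrow> real) \<Rightarrow> bool" where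
  "dep l \<longleftrightarrow> (\<forall>i. n \<le> i \<longrightarrow> l i = 0) \<and> (\<forall>k\<le>d. (\<Sum>i<n. l i * coord i k) = 0)"

lemma inj_p: "inj_on p {..<n}"
  using drawing by (simp add: rectilinear_drawing_def)

lemma dep_lin: "dep u \<Longrightarrow> dep v \<Longrightarrow> dep (\<lambda>i. a * u i + b * v i)"
  by (simp add: dep_def distrib_right sum.distrib mult.assoc sum_distrib_left[symmetric])

lemma dep_sum: "(\<And>x. x \<in> C \<Longrightarrow> dep (u x)) \<Longrightarrow> dep (\<lambda>i. \<Sum>x\<in>C. f x * u x i)"
proof (induction C rule: infinite_finite_induct)
  case (insert x C)
  then have "dep (\<lambda>i. f x * u x i + 1 * (\<Sum>x\<in>C. f x * u x i))" by (intro dep_lin) auto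
  then show ?case using insert by simp
qed (auto simp: dep_def)

lemma dep_restrict:
  assumes "A \<subseteq> {..<n}" "\<And>k. k \<le> d \<Longrightarrow> (\<Sum>i\<in>A. y i * coord i k) = 0"
  shows "dep (\<lambda>i. if i \<in> A then y i else 0)"
proof -
  have "(\<Sum>i<n. (if i \<in> A then y i else 0) * coord i k) = (\<Sum>i\<in>A. y i * coord i k)" for k
    using assms(1) by (intro sum.mono_neutral_cong_right) auto
  then show ?thesis using assms by (auto simp: dep_def)
qed

lemma no_common_hyperplane:
  assumes D: "D \<subseteq> {..<n}" "card D = d + 1" and f: "\<And>i. i \<in> D \<Longrightarrow> (\<Sum>k\<le>d. f k * coord i k) = 0"
  shows "\<forall>k\<le>d. f k = 0"
proof -
  have split: "(\<Sum>k\<le>d. f k * coord i k) = (\<Sum>k<d. f k * Poly_Mapping.lookup (p i) k) + f d" for i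
    by (simp add: lessThan_Suc_atMost[symmetric] coord_def)
  have zero: "\<forall>k<d. f k = 0"
  proof (rule ccontr)
    assume "\<not> (\<forall>k<d. f k = 0)"
    then have "affine_hyperplane d {x \<in> Rspace d. (\<Sum>k<d. f k * Poly_Mapping.lookup x k) = - f d}"
      unfolding affine_hyperplane_def by (intro exI[of _ f] exI[of _ "- f d"]) auto
    moreover have "p ` D \<subseteq> {x \<in> Rspace d. (\<Sum>k<d. f k * Poly_Mapping.lookup x k) = - f d}"
      using f D drawing unfolding split rectilinear_drawing_def by (auto simp: eq_neg_iff_add_eq_0)
    ultimately show False using drawing D unfolding rectilinear_drawing_def by blast
  qed
  obtain i where "i \<in> D" using D by fastforce
  then have "f d = 0" using f[of i] zero unfolding split by simp
  then show ?thesis using zero by (simp add: le_less)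
qed

lemma extend_to_basis:
  assumes "A \<subseteq> U" "U \<subseteq> {..<n}" "card A \<le> d + 1" "d + 1 \<le> card U"
  obtains D where "A \<subseteq> D" "D \<subseteq> U" "card D = d + 1"
  using assms exists_subset_between[of A "d + 1" U] finite_subset[of U "{..<n}"] by auto

lemma dual_functional:
  assumes D: "D \<subseteq> {..<n}" "card D = d + 1" and i: "i \<in> D"
  obtains f where "\<And>l. l \<in> D \<Longrightarrow> (\<Sum>k\<le>d. f k * coord l k) = (if l = i then 1 else 0)"
proof -
  have finD: "finite D" using D finite_subset by blast
  have "card (D - {i}) < card {..d}" using D i finD by simp
  then obtain f where f: "\<exists>k\<in>{..d}. f k \<noteq> 0" "\<forall>l\<in>D - {i}. (\<Sum>k\<le>d. coord l k * f k) = 0"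
    using homogeneous_system_nontrivial[of "D - {i}" "{..d}" coord] finD by auto
  define s where "s = (\<Sum>k\<le>d. f k * coord i k)"
  have zero: "(\<Sum>k\<le>d. f k * coord l k) = 0" if "l \<in> D" "l \<noteq> i" for l
    using f(2) that by (simp add: mult.commute)
  have "s \<noteq> 0"
  proof
    assume "s = 0"
    then have "\<forall>k\<le>d. f k = 0" using zero s_def by (intro no_common_hyperplane[OF D]) metis
    then show False using f(1) by auto
  qed
  then show ?thesis
    using zero by (intro that[of "\<lambda>k. f k / s"]) (auto simp: s_def sum_divide_distrib[symmetric])
qed

lemma dep_small_support:
  assumes l: "dep l" and A: "A \<subseteq> {..<n}" "card A \<le> d + 1" "\<And>i. i \<notin> A \<Longrightarrow> l i = 0"
  shows "l i = 0"
proof (cases "i \<in> A")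
  case True
  obtain D where D: "A \<subseteq> D" "D \<subseteq> {..<n}" "card D = d + 1"
    using extend_to_basis[OF A(1) _ A(2)] large by auto
  obtain f where f: "\<And>l. l \<in> D \<Longrightarrow> (\<Sum>k\<le>d. f k * coord l k) = (if l = i then 1 else 0)"
    using dual_functional[OF D(2,3)] True D(1) by blast
  have "0 = (\<Sum>k\<le>d. f k * (\<Sum>j<n. l j * coord j k))" using l by (simp add: dep_def)
  also have "\<dots> = (\<Sum>k\<le>d. \<Sum>j<n. l j * (f k * coord j k))"
    by (simp add: sum_distrib_left algebra_simps)
  also have "\<dots> = (\<Sum>j<n. l j * (\<Sum>k\<le>d. f k * coord j k))"
    by (subst sum.swap) (simp add: sum_distrib_left)
  also have "\<dots> = (\<Sum>j\<in>D. l j * (\<Sum>k\<le>d. f k * coord j k))"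
    using D A(3) by (intro sum.mono_neutral_right) auto
  also have "\<dots> = (\<Sum>j\<in>D. if j = i then l j else 0)"
    using f by (intro sum.cong) auto
  also have "\<dots> = l i" using True D finite_subset[of D "{..<n}"] by (simp add: subset_iff)
  finally show ?thesis by simp
qed (use A in auto)

lemma dep_through:
  assumes D: "D \<subseteq> {..<n}" "card D = d + 1" and x: "x < n" "x \<notin> D"
  obtains l where "dep l" "l x = 1" "\<And>i. i \<notin> insert x D \<Longrightarrow> l i = 0"
proof -
  have finD: "finite D" using D finite_subset by blast
  have "card {..d} < card (insert x D)" using D x finD by simp
  then obtain y where y: "\<exists>j\<in>insert x D. y j \<noteq> 0"
    "\<forall>k\<in>{..d}. (\<Sum>j\<in>insert x D. coord j k * y j) = 0"
    using homogeneous_system_nontrivial[of "{..d}" "insert x D" "\<lambda>k j. coord j k"] finD by auto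
  define l where "l i = (if i \<in> insert x D then y i else 0)" for i
  have l: "dep l" unfolding l_def
    by (rule dep_restrict) (use D x y in \<open>auto simp: mult.commute\<close>)
  have "l x \<noteq> 0"
  proof
    assume "l x = 0"
    have zero: "l i = 0" for i
      by (rule dep_small_support[OF l D(1)]) (use D \<open>l x = 0\<close> in \<open>auto simp: l_def\<close>)
    obtain j where j: "j \<in> insert x D" "y j \<noteq> 0" using y(1) by blast
    then have "l j = y j" by (simp add: l_def)
    then show False using zero[of j] j by simp
  qed
  then show ?thesis
    using dep_lin[OF l l, of "1 / l x" 0] by (intro that[of "\<lambda>i. l i / l x"]) (auto simp: l_def)
qed

lemma dep_interpolation:
  assumes C: "C \<subseteq> U" and U: "U \<subseteq> {..<n}" and large: "d + 1 \<le> card (U - C)"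
  obtains l where "dep l" "\<And>i. i \<in> C \<Longrightarrow> l i = f i" "\<And>i. i \<notin> U \<Longrightarrow> l i = 0"
proof -
  have finC: "finite C" using C U finite_subset[of C "{..<n}"] by auto
  obtain D where D: "D \<subseteq> U - C" "card D = d + 1"
    using obtain_subset_with_card_n[OF large] by blast
  have "\<forall>x\<in>C. \<exists>l. dep l \<and> l x = 1 \<and> (\<forall>i. i \<notin> insert x D \<longrightarrow> l i = 0)"
  proof
    fix x assume "x \<in> C"
    then have "x < n" "x \<notin> D" "D \<subseteq> {..<n}" using C D U by auto
    then show "\<exists>l. dep l \<and> l x = 1 \<and> (\<forall>i. i \<notin> insert x D \<longrightarrow> l i = 0)"
      using dep_through[of D x] D(2) by metis
  qed
  from bchoice[OF this] obtain L where L: "\<And>x. x \<in> C \<Longrightarrow> dep (L x)" "\<And>x. x \<in> C \<Longrightarrow> L x x = 1"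
    "\<And>x i. x \<in> C \<Longrightarrow> i \<notin> insert x D \<Longrightarrow> L x i = 0" by auto
  show ?thesis
  proof (rule that[of "\<lambda>i. \<Sum>x\<in>C. f x * L x i"])
    show "dep (\<lambda>i. \<Sum>x\<in>C. f x * L x i)" by (rule dep_sum) (rule L)
    show "(\<Sum>x\<in>C. f x * L x i) = f i" if "i \<in> C" for i
    proof -
      have "i \<notin> D" using that D(1) by auto
      then have "L x i = (if x = i then 1 else 0)" if "x \<in> C" for x
        using L(2)[OF that] L(3)[OF that, of i] by auto
      then have "(\<Sum>x\<in>C. f x * L x i) = (\<Sum>x\<in>C. if x = i then f x else 0)"
        by (intro sum.cong) auto
      then show ?thesis using finC that by simp
    qed
    show "(\<Sum>x\<in>C. f x * L x i) = 0" if "i \<notin> U" for i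
    proof (rule sum.neutral, rule ballI)
      fix x assume "x \<in> C"
      then show "f x * L x i = 0" using L(3)[of x i] that D(1) C by auto
    qed
  qed
qed

lemma dep_iff_lincomb:
  "dep l \<longleftrightarrow> (\<forall>i. n \<le> i \<longrightarrow> l i = 0) \<and> (\<Sum>i<n. l i) = 0 \<and> (\<Sum>i<n. l i *\<^sub>R p i) = 0"
proof -
  have key: "Poly_Mapping.lookup (p i) k = 0" if "i < n" "d \<le> k" for i k
  proof -
    have "p i \<in> Rspace d" using drawing that(1) by (auto simp: rectilinear_drawing_def)
    then show ?thesis using that(2) by (force simp: Rspace_def in_keys_iff)
  qed
  have "(\<Sum>i<n. l i *\<^sub>R p i) = 0 \<longleftrightarrow> (\<forall>k. (\<Sum>i<n. l i * Poly_Mapping.lookup (p i) k) = 0)"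
    by (simp add: poly_mapping_eq_iff fun_eq_iff lookup_lincomb)
  also have "\<dots> \<longleftrightarrow> (\<forall>k<d. (\<Sum>i<n. l i * Poly_Mapping.lookup (p i) k) = 0)"
  proof -
    have "(\<Sum>i<n. l i * Poly_Mapping.lookup (p i) k) = 0" if "d \<le> k" for k
      using key that by (intro sum.neutral) auto
    then show ?thesis by (meson not_le)
  qed
  also have "\<dots> \<longleftrightarrow> (\<forall>k<d. (\<Sum>i<n. l i * coord i k) = 0)"
    by (intro all_cong1 imp_cong refl) (auto simp: coord_def)
  finally have 1: "(\<Sum>i<n. l i *\<^sub>R p i) = 0 \<longleftrightarrow> (\<forall>k<d. (\<Sum>i<n. l i * coord i k) = 0)" .
  have 2: "(\<Sum>i<n. l i) = (\<Sum>i<n. l i * coord i d)" by (simp add: coord_def)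
  show ?thesis unfolding 1 2 dep_def by (auto simp: le_less)
qed

lemma positive_combination_in_rel_interior:
  assumes A: "A \<subseteq> {..<n}" "card A \<le> d + 1" and w: "\<And>i. i \<in> A \<Longrightarrow> 0 < w i" "sum w A = 1"
  shows "(\<Sum>i\<in>A. w i *\<^sub>R p i) \<in> rel_interior (convex hull (p ` A))"
proof -
  have finA: "finite A" and injA: "inj_on p A"
    using A finite_subset inj_on_subset[OF inj_p] by blast+
  obtain D where D: "A \<subseteq> D" "D \<subseteq> {..<n}" "card D = d + 1"
    using extend_to_basis[OF A(1) _ A(2)] large by auto
  have "\<forall>i\<in>A. \<exists>f. \<forall>l\<in>D. (\<Sum>k\<le>d. f k * coord l k) = (if l = i then 1 else 0)"
    using dual_functional[OF D(2,3)] D(1) by (metis subsetD)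
  from bchoice[OF this] obtain f where
    f: "\<And>i l. i \<in> A \<Longrightarrow> l \<in> D \<Longrightarrow> (\<Sum>k\<le>d. f i k * coord l k) = (if l = i then 1 else 0)" by auto
  define \<Phi> where "\<Phi> i y = (\<Sum>k<d. f i k * Poly_Mapping.lookup y k) + f i d" for i and y :: point
  have bary: "\<Phi> i (\<Sum>l\<in>A. v l *\<^sub>R p l) = v i" if "i \<in> A" "sum v A = 1" for i v
  proof -
    have "\<Phi> i (\<Sum>l\<in>A. v l *\<^sub>R p l) =
        (\<Sum>l\<in>A. v l * (\<Sum>k<d. f i k * Poly_Mapping.lookup (p l) k)) + f i d * sum v A"
      unfolding \<Phi>_def lookup_lincomb that(2)
      by (simp add: sum_distrib_left mult.left_commute) (rule sum.swap)
    also have "\<dots> = (\<Sum>l\<in>A. v l * (\<Sum>k\<le>d. f i k * coord l k))"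
      by (simp add: lessThan_Suc_atMost[symmetric] coord_def distrib_left sum.distrib
          sum_distrib_right[symmetric] mult.commute[of "f i d"])
    also have "\<dots> = (\<Sum>l\<in>A. if l = i then v l else 0)"
      using f[OF that(1)] D(1) by (intro sum.cong) auto
    finally show ?thesis using finA that by simp
  qed
  define O' where "O' = (\<Inter>i\<in>A. {y. 0 < \<Phi> i y})"
  have "open O'"
    unfolding O'_def \<Phi>_def
    by (intro open_INT finA ballI open_Collect_less continuous_intros continuous_on_lookup)
  moreover have "(\<Sum>i\<in>A. w i *\<^sub>R p i) \<in> O'" using bary w by (auto simp: O'_def)
  moreover have "(\<Sum>i\<in>A. w i *\<^sub>R p i) \<in> convex hull (p ` A)"
    unfolding convex_hull_indexed[OF finA injA] using w by (auto intro: less_imp_le)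
  moreover have "O' \<inter> affine hull (convex hull (p ` A)) \<subseteq> convex hull (p ` A)"
  proof
    fix y assume y: "y \<in> O' \<inter> affine hull (convex hull (p ` A))"
    then have "y \<in> affine hull (p ` A)" by (simp add: affine_hull_convex_hull)
    then obtain v where v: "sum v A = 1" "(\<Sum>i\<in>A. v i *\<^sub>R p i) = y"
      using affine_hull_indexed[OF finA injA] by blast
    have "0 \<le> v i" if "i \<in> A" for i using y bary[OF that v(1)] v(2) that by (force simp: O'_def)
    then show "y \<in> convex hull (p ` A)"
      unfolding convex_hull_indexed[OF finA injA] using v by auto
  qed
  ultimately show ?thesis unfolding mem_rel_interior by blast
qed

lemma crossing_of_dep:
  assumes l: "dep l" and AB: "A \<union> B = {..<n}" "A \<inter> B = {}" "card A \<le> d + 1" "card B \<le> d + 1"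
    and pos: "\<And>i. i \<in> A \<Longrightarrow> 0 < l i" and neg: "\<And>i. i \<in> B \<Longrightarrow> l i < 0"
  shows "crossing p A B"
proof -
  have fin: "finite A" "finite B" using AB(1) by (metis finite_Un finite_lessThan)+
  have split: "(\<Sum>i<n. h i) = (\<Sum>i\<in>A. h i) + (\<Sum>i\<in>B. h i)" for h :: "nat \<Rightarrow> 'z::comm_monoid_add"
    unfolding AB(1)[symmetric] using fin AB(2) by (rule sum.union_disjoint)
  define s where "s = (\<Sum>i\<in>A. l i)"
  have s: "(\<Sum>i\<in>B. - l i) = s" and comb: "(\<Sum>i\<in>A. l i *\<^sub>R p i) = (\<Sum>i\<in>B. (- l i) *\<^sub>R p i)"
    using l unfolding dep_iff_lincomb split s_def by (auto simp: sum_negf eq_neg_iff_add_eq_0)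
  have "A \<noteq> {}"
  proof
    assume "A = {}"
    then have "card {..<n} \<le> d + 1" "B = {..<n}" using AB by auto
    have "l 0 = 0"
      by (rule dep_small_support[OF l, of "{..<n}"])
        (use l \<open>card {..<n} \<le> d + 1\<close> in \<open>simp_all add: dep_def\<close>)
    then show False using neg[of 0] \<open>B = {..<n}\<close> large by auto
  qed
  then have "0 < s" unfolding s_def using fin pos by (intro sum_pos) auto
  have "(\<Sum>i\<in>A. (l i / s) *\<^sub>R p i) = (\<Sum>i\<in>B. (- l i / s) *\<^sub>R p i)"
  proof -
    have "(\<Sum>i\<in>A. (l i / s) *\<^sub>R p i) = (1 / s) *\<^sub>R (\<Sum>i\<in>A. l i *\<^sub>R p i)"
      by (simp add: scaleR_sum_right)
    also have "\<dots> = (\<Sum>i\<in>B. (- l i / s) *\<^sub>R p i)" unfolding comb by (simp add: scaleR_sum_right)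
    finally show ?thesis .
  qed
  moreover have "(\<Sum>i\<in>A. (l i / s) *\<^sub>R p i) \<in> rel_interior (convex hull (p ` A))"
    using AB pos \<open>0 < s\<close>
    by (intro positive_combination_in_rel_interior)
      (auto simp: sum_divide_distrib[symmetric] s_def[symmetric])
  moreover have "(\<Sum>i\<in>B. (- l i / s) *\<^sub>R p i) \<in> rel_interior (convex hull (p ` B))"
  proof (rule positive_combination_in_rel_interior)
    show "(\<Sum>i\<in>B. - l i / s) = 1"
      unfolding sum_divide_distrib[symmetric] s using \<open>0 < s\<close> by simp
  qed (use AB neg \<open>0 < s\<close> in \<open>auto simp: divide_neg_pos\<close>)
  ultimately show ?thesis unfolding crossing_def drawn_hyperedge_def using AB(2) by auto
qed

lemma non_face_dependency:
  assumes P: "polytope P" "polytope_vertices P = p ` {..<n}"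
    and S: "S \<subseteq> {..<n}" and nf: "\<nexists>F. F face_of P \<and> polytope_vertices F = p ` S"
  obtains l where "dep l" "l \<noteq> (\<lambda>_. 0)" "\<And>i. i \<notin> S \<Longrightarrow> 0 \<le> l i"
proof (rule ccontr)
  assume contra: "\<not> thesis"
  have PV: "P = convex hull (p ` {..<n})" using polytope_eq_hull_vertices[OF P(1)] P(2) by simp
  have finS: "finite S" and injS: "inj_on p S"
    using S finite_subset inj_on_subset[OF inj_p] by blast+
  let ?F = "convex hull (p ` S)"
  have F: "?F face_of P"
    unfolding face_of_def
  proof (intro conjI ballI impI)
    show "?F \<subseteq> P" unfolding PV using S by (intro hull_mono) auto
    show "convex ?F" by simp
    fix a b x assume ab: "a \<in> P" "b \<in> P" "x \<in> ?F" "x \<in> open_segment a b"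
    obtain \<alpha> where \<alpha>: "\<forall>i\<in>{..<n}. 0 \<le> \<alpha> i" "sum \<alpha> {..<n} = 1" "(\<Sum>i<n. \<alpha> i *\<^sub>R p i) = a"
      using ab(1) unfolding PV convex_hull_indexed[OF finite_lessThan inj_p] by blast
    obtain \<beta> where \<beta>: "\<forall>i\<in>{..<n}. 0 \<le> \<beta> i" "sum \<beta> {..<n} = 1" "(\<Sum>i<n. \<beta> i *\<^sub>R p i) = b"
      using ab(2) unfolding PV convex_hull_indexed[OF finite_lessThan inj_p] by blast
    obtain \<gamma> where \<gamma>: "\<forall>i\<in>S. 0 \<le> \<gamma> i" "sum \<gamma> S = 1" "(\<Sum>i\<in>S. \<gamma> i *\<^sub>R p i) = x"
      using ab(3) unfolding convex_hull_indexed[OF finS injS] by blast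
    obtain t where t: "0 < t" "t < 1" "x = (1 - t) *\<^sub>R a + t *\<^sub>R b"
      using ab(4) by (auto simp: in_segment)
    define \<gamma>' where "\<gamma>' i = (if i \<in> S then \<gamma> i else 0)" for i
    have \<gamma>': "sum \<gamma>' {..<n} = 1" "(\<Sum>i<n. \<gamma>' i *\<^sub>R p i) = x"
    proof -
      have "sum \<gamma>' {..<n} = sum \<gamma> S"
        unfolding \<gamma>'_def using S by (intro sum.mono_neutral_cong_right) auto
      then show "sum \<gamma>' {..<n} = 1" using \<gamma> by simp
      have "(\<Sum>i<n. \<gamma>' i *\<^sub>R p i) = (\<Sum>i\<in>S. \<gamma> i *\<^sub>R p i)"
        unfolding \<gamma>'_def using S by (intro sum.mono_neutral_cong_right) auto
      then show "(\<Sum>i<n. \<gamma>' i *\<^sub>R p i) = x" using \<gamma> by simp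
    qed
    define l where "l i = (if i < n then (1 - t) * \<alpha> i + t * \<beta> i - \<gamma>' i else 0)" for i
    have "(\<Sum>i<n. l i) = (1 - t) * sum \<alpha> {..<n} + t * sum \<beta> {..<n} - sum \<gamma>' {..<n}"
      by (simp add: l_def sum.distrib sum_subtractf sum_distrib_left)
    then have "(\<Sum>i<n. l i) = 0" using \<alpha> \<beta> \<gamma>' by simp
    moreover have "(\<Sum>i<n. l i *\<^sub>R p i) = (1 - t) *\<^sub>R (\<Sum>i<n. \<alpha> i *\<^sub>R p i)
        + t *\<^sub>R (\<Sum>i<n. \<beta> i *\<^sub>R p i) - (\<Sum>i<n. \<gamma>' i *\<^sub>R p i)"
      by (simp add: l_def sum.distrib sum_subtractf scaleR_sum_right scaleR_add_left scaleR_diff_left)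
    ultimately have "dep l"
      unfolding dep_iff_lincomb \<alpha>(3) \<beta>(3) \<gamma>'(2) t(3) by (auto simp: l_def)
    moreover have "0 \<le> l i" if "i \<notin> S" for i
      using that \<alpha>(1) \<beta>(1) t by (auto simp: l_def \<gamma>'_def intro!: add_nonneg_nonneg mult_nonneg_nonneg)
    ultimately have l0: "l i = 0" for i using contra that by blast
    have ab0: "\<alpha> i = 0 \<and> \<beta> i = 0" if "i \<in> {..<n} - S" for i
    proof -
      have "(1 - t) * \<alpha> i + t * \<beta> i = 0" using l0[of i] that by (auto simp: l_def \<gamma>'_def)
      moreover have "0 \<le> (1 - t) * \<alpha> i" "0 \<le> t * \<beta> i" using \<alpha>(1) \<beta>(1) t that by auto
      ultimately have "(1 - t) * \<alpha> i = 0" "t * \<beta> i = 0" by linarith+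
      then show ?thesis using t by auto
    qed
    have in_F: "(\<Sum>i<n. u i *\<^sub>R p i) \<in> ?F"
      if "\<forall>i\<in>{..<n}. 0 \<le> u i" "sum u {..<n} = 1" "\<forall>i\<in>{..<n} - S. u i = 0" for u
    proof -
      have "sum u {..<n} = sum u S" "(\<Sum>i<n. u i *\<^sub>R p i) = (\<Sum>i\<in>S. u i *\<^sub>R p i)"
        using S that(3) by (auto intro!: sum.mono_neutral_right)
      then show ?thesis unfolding convex_hull_indexed[OF finS injS] using that S by auto
    qed
    show "a \<in> ?F" using in_F[of \<alpha>] \<alpha> ab0 by blast
    show "b \<in> ?F" using in_F[of \<beta>] \<beta> ab0 by blast
  qed
  have "polytope_vertices ?F = p ` S"
  proof
    show "polytope_vertices ?F \<subseteq> p ` S"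
      by (auto simp: polytope_vertices_def dest: extreme_point_of_convex_hull)
    have "p ` S \<subseteq> polytope_vertices P" using S P(2) by auto
    then show "p ` S \<subseteq> polytope_vertices ?F"
      using extreme_point_of_face[OF F] hull_inc[of _ "p ` S" convex] by (auto simp: polytope_vertices_def)
  qed
  then show False using nf F by blast
qed

text \<open>The Caratheodory argument, applied to dependencies.\<close>

lemma small_support_dependency:
  assumes l: "dep l" "l \<noteq> (\<lambda>_. 0)" "\<And>i. i \<notin> S \<Longrightarrow> 0 \<le> l i"
  obtains m where "dep m" "m \<noteq> (\<lambda>_. 0)" "\<And>i. i \<notin> S \<Longrightarrow> 0 \<le> m i" "card {i. m i \<noteq> 0} \<le> d + 2"
proof -
  let ?Q = "\<lambda>m. dep m \<and> m \<noteq> (\<lambda>_. 0) \<and> (\<forall>i. i \<notin> S \<longrightarrow> 0 \<le> m i)"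
  obtain m where m: "?Q m" and min: "\<And>m'. ?Q m' \<Longrightarrow> card {i. m i \<noteq> 0} \<le> card {i. m' i \<noteq> 0}"
    using ex_has_least_nat[of ?Q l "\<lambda>m. card {i. m i \<noteq> 0}"] l by blast
  let ?X = "{i. m i \<noteq> 0}"
  have XV: "?X \<subseteq> {..<n}" using m by (auto simp: dep_def not_less[symmetric])
  then have finX: "finite ?X" using finite_subset by blast
  have "card ?X \<le> d + 2"
  proof (rule ccontr)
    assume big: "\<not> card ?X \<le> d + 2"
    obtain i0 where i0: "i0 \<in> ?X" using m by auto
    have "card (?X - {i0}) > d + 1" using big i0 finX by simp
    then obtain x where x: "x \<in> ?X - {i0}" by (metis card.empty ex_in_conv not_less_zero)
    have "d + 1 \<le> card (?X - {i0} - {x})" using big i0 x finX by (simp add: card_Diff_singleton)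
    from obtain_subset_with_card_n[OF this]
    obtain D where D: "D \<subseteq> ?X - {i0} - {x}" "card D = d + 1" by blast
    then have "D \<subseteq> {..<n}" "x < n" "x \<notin> D" using x XV by auto
    from dep_through[OF this(1) D(2) this(2,3)]
    obtain y where y: "dep y" "y x = 1" "\<And>i. i \<notin> insert x D \<Longrightarrow> y i = 0"
      by blast
    let ?Y = "{i. y i \<noteq> 0}"
    have "?Y \<subseteq> insert x D" using y(3) by auto
    then have YX: "?Y \<subseteq> ?X - {i0}" using D x by auto
    have "finite ?Y" "?Y \<noteq> {}" using YX finX finite_subset y(2) by (auto intro: finite_subset)
    then obtain z where z: "z \<in> ?Y" "\<And>i. i \<in> ?Y \<Longrightarrow> \<bar>m z / y z\<bar> \<le> \<bar>m i / y i\<bar>"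
      using ex_is_arg_min_if_finite[of ?Y "\<lambda>i. \<bar>m i / y i\<bar>"] by (auto simp: is_arg_min_linorder)
    define m' where "m' = (\<lambda>i. 1 * m i + (- m z / y z) * y i)"
    have small: "\<bar>(- m z / y z) * y i\<bar> \<le> \<bar>m i\<bar>" for i
    proof (cases "y i = 0")
      case False
      then have "\<bar>m z / y z\<bar> * \<bar>y i\<bar> \<le> \<bar>m i / y i\<bar> * \<bar>y i\<bar>"
        using z(2)[of i] by (intro mult_right_mono) auto
      then show ?thesis using False by (simp add: abs_mult abs_divide)
    qed simp
    have "dep m'" unfolding m'_def using m y by (intro dep_lin) auto
    moreover have "m' i0 \<noteq> 0" using YX i0 by (auto simp: m'_def)
    moreover have "0 \<le> m' i" if "i \<notin> S" for i
      using m that small[of i] unfolding m'_def by (smt (verit))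
    ultimately have "?Q m'" by auto
    then have "card ?X \<le> card {i. m' i \<noteq> 0}" by (rule min)
    moreover have "{i. m' i \<noteq> 0} \<subseteq> ?X - {z}" using YX z(1) by (auto simp: m'_def)
    then have "card {i. m' i \<noteq> 0} \<le> card (?X - {z})" using finX by (intro card_mono) auto
    moreover have "card (?X - {z}) < card ?X" using finX YX z(1) by (intro card_Diff1_less) auto
    ultimately show False by linarith
  qed
  then show ?thesis using that m by blast
qed

lemma full_support_dependency:
  assumes l: "dep l" "l \<noteq> (\<lambda>_. 0)" "\<And>i. i \<notin> S \<Longrightarrow> 0 \<le> l i" and q: "d + 2 \<le> q" "q \<le> n"
  obtains T u where "T \<subseteq> {..<n}" "card T = q" "dep u" "\<And>i. u i \<noteq> 0 \<longleftrightarrow> i \<in> T"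
    "{i \<in> T. u i < 0} \<subseteq> S"
proof -
  obtain m where m: "dep m" "m \<noteq> (\<lambda>_. 0)" "\<And>i. i \<notin> S \<Longrightarrow> 0 \<le> m i" "card {i. m i \<noteq> 0} \<le> d + 2"
    using small_support_dependency[OF l] by blast
  let ?X = "{i. m i \<noteq> 0}"
  have XV: "?X \<subseteq> {..<n}" using m(1) by (auto simp: dep_def not_less[symmetric])
  have X_big: "d + 1 \<le> card ?X"
  proof (rule ccontr)
    assume few: "\<not> d + 1 \<le> card ?X"
    have "m i = 0" for i by (rule dep_small_support[OF m(1) XV]) (use few in auto)
    then show False using m(2) by auto
  qed
  obtain T where T: "?X \<subseteq> T" "T \<subseteq> {..<n}" "card T = q"
    using exists_subset_between[of ?X q "{..<n}"] XV m(4) q by auto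
  have "T - (T - ?X) = ?X" using T by auto
  then have "d + 1 \<le> card (T - (T - ?X))" using X_big by simp
  from dep_interpolation[OF Diff_subset T(2) this, of "\<lambda>_. 1"]
  obtain y where y: "dep y" "\<And>i. i \<in> T - ?X \<Longrightarrow> y i = 1" "\<And>i. i \<notin> T \<Longrightarrow> y i = 0" by metis
  obtain \<epsilon> where e: "\<epsilon> > 0" "\<And>i. i \<in> T \<Longrightarrow> m i > 0 \<Longrightarrow> m i + \<epsilon> * y i > 0"
    "\<And>i. i \<in> T \<Longrightarrow> m i < 0 \<Longrightarrow> m i + \<epsilon> * y i < 0"
    using perturb_signs[of T m y] finite_subset[OF T(2)] by auto
  define u where "u = (\<lambda>i. 1 * m i + \<epsilon> * y i)"
  have "dep u" unfolding u_def by (intro dep_lin m y)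
  moreover have off: "u i = 0" if "i \<notin> T" for i using that y(3) T(1) by (auto simp: u_def)
  moreover have sgn: "m i > 0 \<and> u i > 0 \<or> m i < 0 \<and> u i < 0 \<or> m i = 0 \<and> u i > 0" if "i \<in> T" for i
    using e(1) e(2,3)[OF that] y(2)[of i] that 
    by (cases "m i" "0 :: real" rule: linorder_cases) (auto simp: u_def)
  moreover have "u i \<noteq> 0 \<longleftrightarrow> i \<in> T" for i using off[of i] sgn[of i] by force
  moreover have "{i \<in> T. u i < 0} \<subseteq> S" using sgn m(3) by force
  ultimately show ?thesis using that[OF T(2,3)] by blast
qed

lemma uniform_rank4_dependencies:
  assumes T: "T \<subseteq> {..<n}" "card T = d + 5" and u0: "dep u0" "\<And>i. u0 i \<noteq> 0 \<longleftrightarrow> i \<in> T"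
  shows "uniform_rank4 T {v. \<exists>u. dep u \<and> (\<forall>i. i \<notin> T \<longrightarrow> u i = 0) \<and> (\<forall>i\<in>T. v i = u i / u0 i)}"
    (is "uniform_rank4 T ?M")
proof
  have finT: "finite T" using T finite_subset by blast
  show "finite T" by (rule finT)
  show "5 \<le> card T" using T by simp
  show "(\<lambda>i. a * v i + b * w i) \<in> ?M" if "v \<in> ?M" "w \<in> ?M" for a b v w
  proof -
    from that obtain v' w' where "dep v'" "\<forall>i. i \<notin> T \<longrightarrow> v' i = 0" "\<forall>i\<in>T. v i = v' i / u0 i"
      "dep w'" "\<forall>i. i \<notin> T \<longrightarrow> w' i = 0" "\<forall>i\<in>T. w i = w' i / u0 i" by blast
    then show ?thesis
      by (auto intro!: exI[of _ "\<lambda>i. a * v' i + b * w' i"] dep_lin simp: add_divide_distrib)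
  qed
  show "(\<lambda>_. 1) \<in> ?M" using u0 by (auto intro!: exI[of _ u0])
  show "\<forall>i\<in>T. v i = 0" if v: "v \<in> ?M" and Q: "Q \<subseteq> T" "card Q = 4" "\<forall>i\<in>Q. v i = 0" for v Q
  proof -
    obtain u where u: "dep u" "\<forall>i. i \<notin> T \<longrightarrow> u i = 0" "\<forall>i\<in>T. v i = u i / u0 i" using v by blast
    have "card (T - Q) \<le> d + 1" using T(2) Q finT by (simp add: card_Diff_subset finite_subset)
    moreover have "u i = 0" if "i \<notin> T - Q" for i
      using that u Q u0(2)[of i] by (cases "i \<in> T") force+
    ultimately have "u i = 0" for i using dep_small_support[OF u(1), of "T - Q"] T(1) by blast
    then show ?thesis using u by simp
  qed
  show "\<exists>u\<in>?M. \<forall>i\<in>Q. u i = f i" if Q: "Q \<subseteq> T" "card Q \<le> 4" for Q f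
  proof -
    have "d + 1 \<le> card (T - Q)" using T(2) Q finT by (simp add: card_Diff_subset finite_subset)
    then obtain u where u: "dep u" "\<And>i. i \<in> Q \<Longrightarrow> u i = f i * u0 i" "\<And>i. i \<notin> T \<Longrightarrow> u i = 0"
      using dep_interpolation[OF Q(1) T(1), of "\<lambda>i. f i * u0 i"] by blast
    then show ?thesis using Q u0(2) by (intro bexI[of _ "\<lambda>i. u i / u0 i"]) auto
  qed
qed

lemma balanced_extension:
  assumes T: "T \<subseteq> {..<n}" "d + 1 \<le> card T" and u: "dep u" and n: "n = 2 * d"
    and R: "R \<subseteq> T" "\<And>i. i \<in> R \<Longrightarrow> 0 < u i" "\<And>i. i \<in> T - R \<Longrightarrow> u i < 0"
    and u_off: "\<And>i. i \<notin> T \<Longrightarrow> u i = 0"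
    and E: "E \<subseteq> {..<n} - T" "card (R \<union> E) = d"
  shows "crossing p (R \<union> E) ({..<n} - (R \<union> E))"
proof -
  let ?C = "{..<n} - T" and ?W = "R \<union> E"
  have CT: "{..<n} - ?C = T" using T by auto
  have "d + 1 \<le> card ({..<n} - ?C)" unfolding CT by (rule T(2))
  from dep_interpolation[OF Diff_subset subset_refl this, of "\<lambda>i. if i \<in> E then 1 else - 1"]
  obtain y where y: "dep y" "\<And>i. i \<in> ?C \<Longrightarrow> y i = (if i \<in> E then 1 else - 1)" by metis
  obtain \<epsilon> where e: "\<epsilon> > 0" "\<And>i. i \<in> T \<Longrightarrow> u i > 0 \<Longrightarrow> u i + \<epsilon> * y i > 0"
    "\<And>i. i \<in> T \<Longrightarrow> u i < 0 \<Longrightarrow> u i + \<epsilon> * y i < 0"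
    using perturb_signs[of T u y] finite_subset[OF T(1)] by auto
  have W: "?W \<subseteq> {..<n}" using R E T by auto
  show ?thesis
  proof (rule crossing_of_dep)
    show "dep (\<lambda>i. 1 * u i + \<epsilon> * y i)" by (intro dep_lin u y)
    show "?W \<union> ({..<n} - ?W) = {..<n}" using W by auto
    show "?W \<inter> ({..<n} - ?W) = {}" by auto
    show "card ?W \<le> d + 1" using E by simp
    have "card ({..<n} - ?W) = n - d" using W E(2) finite_subset[OF W] by (simp add: card_Diff_subset)
    then show "card ({..<n} - ?W) \<le> d + 1" using n by simp
    show "0 < 1 * u i + \<epsilon> * y i" if "i \<in> ?W" for i
    proof (cases "i \<in> T")
      case True
      then have "i \<in> R" using that E by auto
      then show ?thesis using e(2)[OF True] R(2) by simp
    next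
      case False
      then show ?thesis using that R(1) E(1) e(1) y(2)[of i] u_off[of i] by auto
    qed
    show "1 * u i + \<epsilon> * y i < 0" if "i \<in> {..<n} - ?W" for i
    proof (cases "i \<in> T")
      case True
      then show ?thesis using e(3)[OF True] R(3)[of i] that by simp
    next
      case False
      then show ?thesis using that e(1) y(2)[of i] u_off[of i] by auto
    qed
  qed
qed

lemma card_crossing_halves:
  assumes n: "n = 2 * d"
  shows "finite {W. W \<subseteq> {..<n} \<and> card W = d \<and> crossing p W ({..<n} - W)}"
    and "card {W. W \<subseteq> {..<n} \<and> card W = d \<and> crossing p W ({..<n} - W)} \<le> 2 * card (crossing_pairs n d p)"
proof -
  let ?W = "{W. W \<subseteq> {..<n} \<and> card W = d \<and> crossing p W ({..<n} - W)}"
  show finW: "finite ?W" by (rule finite_subset[of _ "Pow {..<n}"]) auto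
  have fin: "finite (crossing_pairs n d p)"
    by (rule finite_subset[of _ "Pow (Pow {..<n})"])
      (auto simp: crossing_pairs_def complete_hyperedges_def)
  have sub: "?W \<subseteq> \<Union>(crossing_pairs n d p)"
  proof
    fix W assume W: "W \<in> ?W"
    then have "card ({..<n} - W) = d" using n by (subst card_Diff_subset) (auto intro: finite_subset)
    then have "{W, {..<n} - W} \<in> crossing_pairs n d p"
      using W unfolding crossing_pairs_def complete_hyperedges_def by blast
    then show "W \<in> \<Union>(crossing_pairs n d p)" by blast
  qed
  have c2: "finite X \<and> card X \<le> 2" if "X \<in> crossing_pairs n d p" for X
    using that by (auto simp: crossing_pairs_def card_insert_if)
  have "card ?W \<le> card (\<Union>(crossing_pairs n d p))"
    using sub fin c2 by (intro card_mono) auto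
  also have "\<dots> \<le> (\<Sum>X\<in>crossing_pairs n d p. card X)"
    using card_UN_le[OF fin, of "\<lambda>X. X"] by simp
  also have "\<dots> \<le> (\<Sum>X\<in>crossing_pairs n d p. 2)" using c2 by (intro sum_mono) auto
  finally show "card ?W \<le> 2 * card (crossing_pairs n d p)" by simp
qed

lemma crossing_pairs_bound:
  assumes n: "n = 2 * d" and d5: "5 \<le> d"
    and l: "dep l" "l \<noteq> (\<lambda>_. 0)" "\<And>i. i \<notin> S \<Longrightarrow> 0 \<le> l i" and S: "finite S" "card S \<le> s"
    and b: "\<And>r. (d + 5) div 2 \<le> r + s \<Longrightarrow> r \<le> (d + 5) div 2 + s \<Longrightarrow> r \<le> d \<and> b \<le> (d - 5) choose (d - r)"
  shows "((d + 5) choose 2) * b \<le> 12 * card (crossing_pairs n d p)"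
proof -
  have q: "d + 2 \<le> d + 5" "d + 5 \<le> n" using n d5 by auto
  obtain T u0 where T: "T \<subseteq> {..<n}" "card T = d + 5" and u0: "dep u0" "\<And>i. u0 i \<noteq> 0 \<longleftrightarrow> i \<in> T"
    and N: "{i \<in> T. u0 i < 0} \<subseteq> S"
    using full_support_dependency[OF l(1,2) _ q, of S] l(3) by blast
  have finT: "finite T" using T finite_subset by blast
  interpret uniform_rank4 T "{v. \<exists>u. dep u \<and> (\<forall>i. i \<notin> T \<longrightarrow> u i = 0) \<and> (\<forall>i\<in>T. v i = u i / u0 i)}"
    by (rule uniform_rank4_dependencies[OF T u0])
  let ?C = "{..<n} - T"
  have cC: "card ?C = d - 5" using T n finT by (simp add: card_Diff_subset)
  define R where "R A = {i \<in> T. 0 < u0 i \<longleftrightarrow> i \<in> A}" for A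
  define W where "W = {W. W \<subseteq> {..<n} \<and> card W = d \<and> crossing p W ({..<n} - W)}"
  have R_dep: "\<exists>u. dep u \<and> (\<forall>i. i \<notin> T \<longrightarrow> u i = 0) \<and> (\<forall>i\<in>R A. 0 < u i) \<and> (\<forall>i\<in>T - R A. u i < 0)"
    if A: "A \<in> halves" for A
  proof -
    obtain v u where v: "\<forall>i\<in>A. 0 < v i" "\<forall>i\<in>T - A. v i < 0"
      and u: "dep u" "\<forall>i. i \<notin> T \<longrightarrow> u i = 0" "\<forall>i\<in>T. v i = u i / u0 i"
      using A unfolding halves_def by blast
    have uv: "u i = v i * u0 i" if "i \<in> T" for i using u(3) u0(2)[of i] that by simp
    have u0_neg: "u0 i < 0" if "i \<in> T" "\<not> 0 < u0 i" for i using u0(2)[of i] that by linarith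
    have "0 < u i" if "i \<in> R A" for i
      using that v u0_neg[of i] uv[of i]
      by (cases "i \<in> A") (auto simp: R_def intro: mult_pos_pos mult_neg_neg)
    moreover have "u i < 0" if "i \<in> T - R A" for i
      using that v u0_neg[of i] uv[of i]
      by (cases "i \<in> A") (auto simp: R_def intro: mult_pos_neg mult_neg_pos)
    ultimately show ?thesis using u by blast
  qed
  have R_card: "(d + 5) div 2 \<le> card (R A) + s" "card (R A) \<le> (d + 5) div 2 + s" if "A \<in> halves" for A
  proof -
    have A: "A \<subseteq> T" "card A = (d + 5) div 2" using that T by (auto simp: halves_def)
    have fin: "finite A" "finite (R A)" using A finT finite_subset by (auto simp: R_def)
    have "0 < u0 i" if "i \<in> T - S" for i
    proof -
      have "u0 i \<noteq> 0" "\<not> u0 i < 0" using that N u0(2)[of i] by auto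
      then show ?thesis by linarith
    qed
    then have "A \<subseteq> R A \<union> S" "R A \<subseteq> A \<union> S" using A by (auto simp: R_def)
    then have "card A \<le> card (R A \<union> S)" "card (R A) \<le> card (A \<union> S)"
      using fin S by (auto intro!: card_mono)
    then show "(d + 5) div 2 \<le> card (R A) + s" "card (R A) \<le> (d + 5) div 2 + s"
      using card_Un_le[of "R A" S] card_Un_le[of A S] A(2) S(2) by linarith+
  qed
  define X where "X = (SIGMA A:halves. {E. E \<subseteq> ?C \<and> card E = d - card (R A)})"
  have fin_halves: "finite halves"
    by (rule finite_subset[of _ "Pow T"]) (auto simp: halves_def finT)
  have "card halves * b \<le> (\<Sum>A\<in>halves. (d - 5) choose (d - card (R A)))"
    using sum_mono[of halves "\<lambda>_. b" "\<lambda>A. (d - 5) choose (d - card (R A))"] b R_card by simp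
  also have "\<dots> = card X"
    unfolding X_def using fin_halves by (simp add: card_SigmaI n_subsets cC)
  also have "card X \<le> card W"
  proof (rule card_inj_on_le[of "\<lambda>(A, E). R A \<union> E"])
    show "finite W" unfolding W_def by (rule card_crossing_halves[OF n])
    show "inj_on (\<lambda>(A, E). R A \<union> E) X"
    proof (rule inj_onI, clarify)
      fix A E A' E' assume AE: "(A, E) \<in> X" "(A', E') \<in> X" and eq: "R A \<union> E = R A' \<union> E'"
      have sub: "A \<subseteq> T" "A' \<subseteq> T" "E \<inter> T = {}" "E' \<inter> T = {}"
        using AE by (auto simp: X_def halves_def)
      have RT: "R A \<subseteq> T" "R A' \<subseteq> T" by (auto simp: R_def)
      have "R A = R A'" "E = E'" using eq sub RT by blast+
      moreover have "A = A'"
      proof (rule set_eqI)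
        fix i
        have "i \<in> R A \<longleftrightarrow> i \<in> R A'" using \<open>R A = R A'\<close> by simp
        then show "i \<in> A \<longleftrightarrow> i \<in> A'" using sub by (auto simp: R_def)
      qed
      ultimately show "A = A' \<and> E = E'" by simp
    qed
    show "(\<lambda>(A, E). R A \<union> E) ` X \<subseteq> W"
    proof clarify
      fix A E assume "(A, E) \<in> X"
      then have A: "A \<in> halves" and E: "E \<subseteq> ?C" "card E = d - card (R A)" by (auto simp: X_def)
      obtain u where u: "dep u" "\<forall>i. i \<notin> T \<longrightarrow> u i = 0" "\<forall>i\<in>R A. 0 < u i" "\<forall>i\<in>T - R A. u i < 0"
        using R_dep[OF A] by blast
      have RT: "R A \<subseteq> T" by (auto simp: R_def)
      have "card (R A \<union> E) = card (R A) + card E"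
        using RT E(1) finT finite_subset by (intro card_Un_disjoint) (auto intro: finite_subset)
      then have "card (R A \<union> E) = d" using E(2) b[OF R_card[OF A]] by simp
      moreover then have "crossing p (R A \<union> E) ({..<n} - (R A \<union> E))"
        using T u RT E(1) by (intro balanced_extension[of T u]) (auto simp: n)
      ultimately show "R A \<union> E \<in> W" using RT T E(1) by (auto simp: W_def)
    qed
  qed
  also have "\<dots> \<le> 2 * card (crossing_pairs n d p)"
    unfolding W_def by (rule card_crossing_halves[OF n])
  finally have "card halves * b \<le> 2 * card (crossing_pairs n d p)" .
  moreover have "((d + 5) choose 2) * b \<le> 6 * card halves * b"
    using card_halves T by (intro mult_right_mono) auto
  ultimately show ?thesis by linarith
qed

end

section \<open>The lower bound\<close>

lemma central_binomial_sqrt_bound: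
  assumes "1 \<le> l"
  shows "4 ^ l \<le> 2 * sqrt (real l) * real ((2 * l) choose l)"
  using assms
proof (induction l rule: nat_induct_at_least)
  case base
  show ?case by (simp add: choose_two numeral_2_eq_2)
next
  case (Suc l)
  have step: "real ((2 * Suc l) choose Suc l) * real (Suc l) = 2 * real (2 * l + 1) * real ((2 * l) choose l)"
  proof -
    have "Suc l * ((2 * Suc l) choose Suc l) = (2 * Suc l) * (Suc (2 * l) choose l)"
      using Suc_times_binomial_eq[of "Suc (2 * l)" l] by (simp add: mult.commute)
    moreover have "Suc l * (Suc (2 * l) choose l) = Suc (2 * l) * ((2 * l) choose l)"
    proof -
      have "Suc (2 * l) choose l = Suc (2 * l) choose Suc l"
        using binomial_symmetric[of l "Suc (2 * l)"] by simp
      then show ?thesis using Suc_times_binomial_eq[of "2 * l" l] by (simp add: mult.commute)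
    qed
    ultimately have "Suc l * (Suc l * ((2 * Suc l) choose Suc l)) = Suc l * (2 * (Suc (2 * l) * ((2 * l) choose l)))"
      by (metis mult.assoc mult.left_commute)
    then have "Suc l * ((2 * Suc l) choose Suc l) = 2 * (Suc (2 * l) * ((2 * l) choose l))"
      by (rule nat_mult_eq_cancel1[THEN iffD1, rotated]) simp
    moreover have "real x * real (Suc l) = 2 * real (2 * l + 1) * real y"
      if "Suc l * x = 2 * (Suc (2 * l) * y)" for x y
      using arg_cong[OF that, of real] by (simp add: algebra_simps)
    ultimately show ?thesis by blast
  qed
  have "sqrt (real l) * sqrt (real (Suc l)) \<le> (2 * real l + 1) / 2"
  proof -
    have "sqrt (real l) * sqrt (real (Suc l)) = sqrt (real l * real (Suc l))"
      by (simp add: real_sqrt_mult)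
    also have "\<dots> \<le> (2 * real l + 1) / 2"
      by (rule real_le_lsqrt) (auto simp: power2_eq_square field_simps)
    finally show ?thesis .
  qed
  then have "4 * sqrt (real l) * sqrt (real (Suc l)) \<le> 2 * real (2 * l + 1)" by simp
  then have "4 * sqrt (real l) * sqrt (real (Suc l)) * real ((2 * l) choose l)
      \<le> 2 * real (2 * l + 1) * real ((2 * l) choose l)"
    by (intro mult_right_mono) auto
  also have "\<dots> = real ((2 * Suc l) choose Suc l) * (sqrt (real (Suc l)) * sqrt (real (Suc l)))"
    unfolding step[symmetric] by (simp only: real_sqrt_mult_self abs_of_nat)
  finally have "4 * sqrt (real l) * real ((2 * l) choose l) * sqrt (real (Suc l))
      \<le> real ((2 * Suc l) choose Suc l) * sqrt (real (Suc l)) * sqrt (real (Suc l))"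
    by (simp only: mult_ac)
  then have "4 * sqrt (real l) * real ((2 * l) choose l) \<le> real ((2 * Suc l) choose Suc l) * sqrt (real (Suc l))"
    by (rule mult_right_le_imp_le) simp
  moreover have "4 * z \<le> 2 * b * x" if "z \<le> 2 * a * y" "4 * a * y \<le> x * b" for a b x y z :: real
    using that by (simp add: algebra_simps)
  ultimately show ?case using Suc.IH unfolding power_Suc by blast
qed

lemma binomial_sqrt_bound:
  assumes "1 \<le> l" "l \<le> k" "k + l \<le> m"
  shows "4 ^ l / (2 * sqrt (real m)) \<le> real (m choose k)"
proof -
  have "(2 * l) choose l \<le> (k + l) choose l" using assms by (intro binomial_right_mono) auto
  also have "\<dots> = (k + l) choose k" using binomial_symmetric[of l "k + l"] by simp
  also have "\<dots> \<le> m choose k" using assms by (intro binomial_right_mono)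
  finally have c: "(2 * l) choose l \<le> m choose k" .
  have "4 ^ l \<le> 2 * sqrt (real l) * real ((2 * l) choose l)"
    by (rule central_binomial_sqrt_bound[OF assms(1)])
  also have "\<dots> \<le> 2 * sqrt (real m) * real (m choose k)"
    using c assms by (intro mult_mono) auto
  finally show ?thesis using assms by (simp add: field_simps)
qed

theorem theorem3:
  fixes t :: nat
  assumes "t \<ge> 1"
  shows "\<exists>(c::real) > 0. \<exists>d0::nat. \<forall>d\<ge>d0. \<forall>(p :: nat \<Rightarrow> point) (P :: point set).
           rectilinear_drawing (2 * d) d p \<and>
           full_dim_polytope d P \<and> polytope_vertices P = p ` {..<2 * d} \<and>
           neighborly t P \<and> \<not> neighborly (t + 1) P
           \<longrightarrow> c * 2 ^ d * real d powr (3 / 2) \<le> real (card (crossing_pairs (2 * d) d p))"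
proof -
  define s where "s = t + 1"
  define c :: real where "c = 1 / (48 * 2 ^ (2 * s + 7))"
  have main: "c * 2 ^ d * real d powr (3 / 2) \<le> real (card (crossing_pairs (2 * d) d p))"
    if d: "2 * s + 10 \<le> d" and dr: "rectilinear_drawing (2 * d) d p"
      and P: "full_dim_polytope d P" "polytope_vertices P = p ` {..<2 * d}" "\<not> neighborly s P"
    for d p P
  proof -
    interpret drawing "2 * d" d p using dr d by unfold_locales auto
    obtain S0 where S0: "S0 \<subseteq> p ` {..<2 * d}" "finite S0" "card S0 \<le> s"
      "\<nexists>F. F face_of P \<and> polytope_vertices F = S0"
      using P(2,3) unfolding neighborly_def by auto
    obtain S where S: "S \<subseteq> {..<2 * d}" "S0 = p ` S" using S0(1) by (metis subset_imageE)
    have cS: "card S \<le> s" using S0(3) S card_image[OF inj_on_subset[OF inj_p S(1)]] by simp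
    have finS: "finite S" using S(1) finite_subset by blast
    obtain l where l: "dep l" "l \<noteq> (\<lambda>_. 0)" "\<And>i. i \<notin> S \<Longrightarrow> 0 \<le> l i"
      using non_face_dependency[of P S] P S S0(4) unfolding full_dim_polytope_def by metis
    define q where "q = d div 2 - s - 3"
    define b where "b = nat \<lceil>4 ^ q / (2 * sqrt (real (d - 5)))\<rceil>"
    have b: "r \<le> d \<and> b \<le> (d - 5) choose (d - r)"
      if r: "(d + 5) div 2 \<le> r + s" "r \<le> (d + 5) div 2 + s" for r
    proof -
      have "1 \<le> q" "q \<le> d - r" "(d - r) + q \<le> d - 5" "r \<le> d" using r d unfolding q_def by linarith+
      then have "4 ^ q / (2 * sqrt (real (d - 5))) \<le> real ((d - 5) choose (d - r))"
        by (intro binomial_sqrt_bound)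
      then have "b \<le> (d - 5) choose (d - r)" unfolding b_def by (simp add: ceiling_le_iff nat_le_iff)
      then show ?thesis using \<open>r \<le> d\<close> by simp
    qed
    have card_bound: "((d + 5) choose 2) * b \<le> 12 * card (crossing_pairs (2 * d) d p)"
      using crossing_pairs_bound[OF refl _ l finS cS b] d by simp
    have sq: "(real d)\<^sup>2 / 2 \<le> real ((d + 5) choose 2)"
    proof -
      have "2 * ((d + 5) choose 2) = (d + 5) * (d + 4)" by (simp add: choose_two)
      then have "2 * real ((d + 5) choose 2) = real ((d + 5) * (d + 4))"
        by (metis of_nat_mult of_nat_numeral)
      then show ?thesis by (simp add: power2_eq_square algebra_simps)
    qed
    have "2 ^ d / 2 ^ (2 * s + 7) \<le> (4 :: real) ^ q"
    proof -
      have "d \<le> 2 * q + (2 * s + 7)" using d unfolding q_def by linarith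
      then have "(2 :: real) ^ d \<le> 2 ^ (2 * q + (2 * s + 7))" by (intro power_increasing) auto
      also have "\<dots> = 4 ^ q * 2 ^ (2 * s + 7)" by (simp add: power_add power_mult)
      finally show ?thesis by (simp add: pos_divide_le_eq)
    qed
    then have "2 ^ d / 2 ^ (2 * s + 7) / (2 * sqrt (real d)) \<le> 4 ^ q / (2 * sqrt (real (d - 5)))"
      using d by (intro frac_le) auto
    also have "\<dots> \<le> real b" unfolding b_def by linarith
    finally have b_low: "2 ^ d / 2 ^ (2 * s + 7) / (2 * sqrt (real d)) \<le> real b" .
    have "real d powr (3 / 2) = (real d)\<^sup>2 / sqrt (real d)"
    proof -
      have "real d powr (3 / 2) = real d powr (2 - 1 / 2)" by simp
      also have "\<dots> = real d powr 2 / real d powr (1 / 2)" by (rule powr_diff)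
      finally show ?thesis using d by (simp add: powr_half_sqrt)
    qed
    then have "12 * (c * 2 ^ d * real d powr (3 / 2)) =
        (real d)\<^sup>2 / 2 * (2 ^ d / 2 ^ (2 * s + 7) / (2 * sqrt (real d)))"
      by (simp add: c_def mult_ac)
    also have "\<dots> \<le> real ((d + 5) choose 2) * real b"
      using sq b_low by (intro mult_mono) auto
    also have "\<dots> = real (((d + 5) choose 2) * b)" by simp
    also have "\<dots> \<le> real (12 * card (crossing_pairs (2 * d) d p))"
      using card_bound by (simp only: of_nat_le_iff)
    finally show ?thesis by simp
  qed
  have "c > 0" by (simp add: c_def)
  then show ?thesis using main unfolding s_def by blast
qed

end
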